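(* Let $f:\mathbb{R}^m\to\mathbb{R}$ be a $C^2$ function which satisfies the Lojasiewicz gradient inequality (in the sense defined in the context). Let $\{x_n\}$ be a sequence constructed by the algorithm New Q-Newton's method Backtracking G (defined in the context) applied to $f$. Assume also that the exponent $\tau$ of the algorithm satisfies $0<\tau\le 1$. 1) Assume that $f$ has at most countably many critical points, and that $\nabla f$ satisfies the Lojasiewicz gradient inequality. Then either $\lim_{n\to\infty}\|x_n\|=\infty$ or $\{x_n\}$ converges to a critical point of $f$. 2) Assume that for all critical points $x^*$ of $f$ we have $\mu(x^* )\times(1+\tau)<1$, where $\mu(x^* )$ is the Lojasiewicz exponent of $f$ at $x^*$. For $\tau=1$, assume moreover that $\nabla f$ also satisfies the Lojasiewicz gradient inequality. Then either $\lim_{n\to\infty}\|x_n\|=\infty$ or $\{x_n\}$ converges to a critical point of $f$. 3) Assume that whenever a subsequence $\{x_{k_n}\}$ converges, we have $$\liminf_{n\to\infty}\frac{\min_{i\in\Lambda_{k_n}}\|A_{k_n}e_{i,k_n}\|}{\max_{i\in\Lambda_{k_n}}\|A_{k_n}e_{i,k_n}\|}>0,$$ where $\Lambda_{k_n}=\{i:\ \langle\nabla f(x_{k_n}),e_{i,k_n}\rangle\ne 0\}$. Moreover, if $\tau=1$, assume that $\nabla f$ also satisfies the Lojasiewicz gradient inequality. Then either $\lim_{n\to\infty}\|x_n\|=\infty$ or $\{x_n\}$ converges to a critical point of $f$.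
   Context: Notation. $\langle\cdot,\cdot\rangle$ and $\|\cdot\|$ are the Euclidean inner product and norm on $\mathbb{R}^m$; $\nabla f$ and $\nabla^2 f$ are the gradient and Hessian of $f$; a critical point of $f$ is a point where $\nabla f=0$; $Id$ is the $m\times m$ identity matrix. For a symmetric real matrix $A$, $minsp(A):=\min_{\|e\|=1}\|Ae\|$ (equivalently, the minimum of $|\lambda|$ over the eigenvalues $\lambda$ of $A$). Algorithm New Q-Newton's method Backtracking G. Given: pairwise distinct real numbers $\delta_0,\ldots,\delta_m$ (chosen randomly), $\tau>0$ and $0<\gamma_0<1$. Put $\kappa:=\frac12\min_{i\ne j}|\delta_i-\delta_j|$. Starting from $x_0\in\mathbb{R}^m$, for $k=0,1,2,\ldots$: if $\nabla f(x_k)=0$, put $x_{k+1}=x_k$. If $\nabla f(x_k)\neq 0$: - let $j$ be the smallest index in $\{0,\ldots,m\}$ with $minsp(\nabla^2 f(x_k)+\delta_j\|\nabla f(x_k)\|^{\tau}Id)\ge\kappa\|\nabla f(x_k)\|^{\tau}$, and put $A_k:=\nabla^2 f(x_k)+\delta_j\|\nabla f(x_k)\|^{\tau}Id$; - let $e_{1,k},\ldots,e_{m,k}$ be an (appropriately chosen) orthonormal basis of $\mathbb{R}^m$; the general algorithm leaves this choice free; - put $w_k:=\sum_{i=1}^m\frac{\langle\nabla f(x_k),e_{i,k}\rangle}{\|A_ke_{i,k}\|}e_{i,k}$ and $\widehat{w_k}:=w_k/\max\{1,\|w_k\|\}$; - let $\gamma$ be the first element of the sequence $\gamma_0,\gamma_0/3,\gamma_0/9,\ldots$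 satisfying Armijo's condition $f(x_k-\gamma\widehat{w_k})-f(x_k)\le-\frac13\gamma\langle\widehat{w_k},\nabla f(x_k)\rangle$; - put $x_{k+1}:=x_k-\gamma\widehat{w_k}$. Lojasiewicz gradient inequality. A function $f$ satisfies the Lojasiewicz gradient inequality at a point $x^*$ if there are a small neighbourhood $U$ of $x^*$, a constant $0<\mu<1$ and a constant $C>0$ such that $|f(x)-f(y)|^{\mu}\le C\|\nabla f(x)\|$ for all $x,y\in U$. The inequality for $f$ and for $\nabla f$ is needed only near critical points of $f$. Lojasiewicz exponent. If $f$ has the Lojasiewicz gradient inequality near its critical points, then for each critical point $x^*$ of $f$, $\mu(x^* )$ is the infimum of all $\mu$ for which there are an open neighbourhood $U$ of $x^*$ and a constant $C>0$ such that $|f(x)-f(y)|^{\mu}\le C\|\nabla f(x)\|$ for all $x,y\in U$. Lojasiewicz gradient inequality for the gradient. $\nabla f$ satisfies the Lojasiewicz gradient inequality at a point $x^*$ if the function $F:\mathbb{R}^{2m}\to\mathbb{R}$, $F(x,y)=\langle\nabla f(x),y\rangle$, satisfies the Lojasiewicz gradient inequality. *)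

theory Defs
  imports "HOL-Analysis.Analysis"
begin

definition gradient :: "('a::real_inner \<Rightarrow> real) \<Rightarrow> 'a \<Rightarrow> 'a" where
  "gradient f x = (THE D. GDERIV f x :> D)"

lemma gradient_eqI: "GDERIV f x :> D \<Longrightarrow> gradient f x = D"
proof -
  assume D: "GDERIV f x :> D"
  have "D' = D" if "GDERIV f x :> D'" for D'
  proof -
    have "(\<lambda>h. h \<bullet> D') = (\<lambda>h. h \<bullet> D)"
      using has_derivative_unique D that unfolding gderiv_def by blast
    then show "D' = D" by (metis inner_commute vector_eq_rdot)
  qed
  with D show "gradient f x = D" unfolding gradient_def by blast
qed

definition hessian :: "(real^'n \<Rightarrow> real) \<Rightarrow> real^'n \<Rightarrow> real^'n^'n" where
  "hessian f x = jacobian (gradient f) (at x)"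

definition C2_function :: "(real^'n \<Rightarrow> real) \<Rightarrow> bool" where
  "C2_function f \<longleftrightarrow>
     f differentiable_on UNIV \<and> gradient f differentiable_on UNIV \<and> continuous_on UNIV (hessian f)"

definition critical_point :: "('a::real_inner \<Rightarrow> real) \<Rightarrow> 'a \<Rightarrow> bool" where
  "critical_point f x \<longleftrightarrow> gradient f x = 0"

(* The infimum is attained for every matrix, by compactness of the unit sphere. *)
definition minsp :: "real^'n^'n \<Rightarrow> real" where
  "minsp A = (INF e\<in>sphere 0 1. norm (A *v e))"

definition orthonormal_basis :: "('n \<Rightarrow> real^'n) \<Rightarrow> bool" where
  "orthonormal_basis e \<longleftrightarrow>
     (\<forall>i j. e i \<bullet> e j = (if i = j then 1 else 0)) \<and> span (range e) = UNIV"


definition lojasiewicz_ineq :: "('a::real_inner \<Rightarrow> real) \<Rightarrow> 'a \<Rightarrow> real \<Rightarrow> bool" where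
  "lojasiewicz_ineq f z \<mu> \<longleftrightarrow>
     (\<exists>U C. open U \<and> z \<in> U \<and> 0 < C \<and>
        (\<forall>x\<in>U. \<forall>y\<in>U. \<bar>f x - f y\<bar> powr \<mu> \<le> C * norm (gradient f x)))"

definition lojasiewicz_at :: "('a::real_inner \<Rightarrow> real) \<Rightarrow> 'a \<Rightarrow> bool" where
  "lojasiewicz_at f z \<longleftrightarrow> (\<exists>\<mu>. 0 < \<mu> \<and> \<mu> < 1 \<and> lojasiewicz_ineq f z \<mu>)"

definition lojasiewicz :: "('a::real_inner \<Rightarrow> real) \<Rightarrow> bool" where
  "lojasiewicz f \<longleftrightarrow> (\<forall>z. critical_point f z \<longrightarrow> lojasiewicz_at f z)"

(* Only positive exponents are considered: for a locally constant f the inequality holds with every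
   real exponent, since 0 powr \<mu> = 0 also for \<mu> <= 0. *)
definition lojasiewicz_exponent :: "('a::real_inner \<Rightarrow> real) \<Rightarrow> 'a \<Rightarrow> real" where
  "lojasiewicz_exponent f z = Inf {\<mu>. 0 < \<mu> \<and> lojasiewicz_ineq f z \<mu>}"

(* The inequality for grad f at z is that of F(x, y) = <grad f x, y> at the points (z, y) above z.
   As F is linear in y, scaling y shows that the single point (z, 0) already yields all of them. *)
definition gradient_lojasiewicz_at :: "('a::real_inner \<Rightarrow> real) \<Rightarrow> 'a \<Rightarrow> bool" where
  "gradient_lojasiewicz_at f z \<longleftrightarrow>
     (\<forall>y. lojasiewicz_at (\<lambda>p::'a \<times> 'a. gradient f (fst p) \<bullet> snd p) (z, y))"

definition gradient_lojasiewicz :: "('a::real_inner \<Rightarrow> real) \<Rightarrow> bool" where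
  "gradient_lojasiewicz f \<longleftrightarrow> (\<forall>z. critical_point f z \<longrightarrow> gradient_lojasiewicz_at f z)"


text \<open>
  New Q-Newton's method Backtracking G on \<^typ>\<open>real^'n\<close>, with m = \<^term>\<open>CARD('n)\<close>. The shifts are
  \<^term>\<open>\<delta> 0\<close>, ..., \<^term>\<open>\<delta> CARD('n)\<close>; other values of \<^term>\<open>\<delta>\<close> are ignored.
\<close>

definition nqn_kappa :: "nat \<Rightarrow> (nat \<Rightarrow> real) \<Rightarrow> real" where
  "nqn_kappa m \<delta> = 1/2 * Min {\<bar>\<delta> i - \<delta> j\<bar> | i j. i \<le> m \<and> j \<le> m \<and> i \<noteq> j}"

definition nqn_shift :: "(real^'n \<Rightarrow> real) \<Rightarrow> (nat \<Rightarrow> real) \<Rightarrow> real \<Rightarrow> real^'n \<Rightarrow> nat \<Rightarrow> real^'n^'n" where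
  "nqn_shift f \<delta> \<tau> x j = hessian f x + (\<delta> j * norm (gradient f x) powr \<tau>) *\<^sub>R mat 1"

(* For a C2 function and pairwise distinct shifts, a suitable j always exists: each of the m
   eigenvalues of the symmetric Hessian rules out at most one of the m + 1 shifts. *)
definition nqn_matrix :: "(real^'n \<Rightarrow> real) \<Rightarrow> (nat \<Rightarrow> real) \<Rightarrow> real \<Rightarrow> real^'n \<Rightarrow> real^'n^'n" where
  "nqn_matrix f \<delta> \<tau> x =
     nqn_shift f \<delta> \<tau> x
       (LEAST j. j \<le> CARD('n) \<and>
          minsp (nqn_shift f \<delta> \<tau> x j) \<ge> nqn_kappa CARD('n) \<delta> * norm (gradient f x) powr \<tau>)"

definition nqn_w :: "(real^'n \<Rightarrow> real) \<Rightarrow> (nat \<Rightarrow> real) \<Rightarrow> real \<Rightarrow> ('n \<Rightarrow> real^'n) \<Rightarrow> real^'n \<Rightarrow> real^'n" where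
  "nqn_w f \<delta> \<tau> e x =
     (\<Sum>i\<in>UNIV. (gradient f x \<bullet> e i / norm (nqn_matrix f \<delta> \<tau> x *v e i)) *\<^sub>R e i)"

definition nqn_w_hat :: "(real^'n \<Rightarrow> real) \<Rightarrow> (nat \<Rightarrow> real) \<Rightarrow> real \<Rightarrow> ('n \<Rightarrow> real^'n) \<Rightarrow> real^'n \<Rightarrow> real^'n" where
  "nqn_w_hat f \<delta> \<tau> e x = nqn_w f \<delta> \<tau> e x /\<^sub>R max 1 (norm (nqn_w f \<delta> \<tau> e x))"

definition armijo :: "('a::real_inner \<Rightarrow> real) \<Rightarrow> 'a \<Rightarrow> 'a \<Rightarrow> real \<Rightarrow> bool" where
  "armijo f x w \<gamma> \<longleftrightarrow> f (x - \<gamma> *\<^sub>R w) - f x \<le> - (1/3) * \<gamma> * (w \<bullet> gradient f x)"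

definition armijo_step :: "('a::real_inner \<Rightarrow> real) \<Rightarrow> real \<Rightarrow> 'a \<Rightarrow> 'a \<Rightarrow> real" where
  "armijo_step f \<gamma>\<^sub>0 x w = \<gamma>\<^sub>0 / 3 ^ (LEAST l. armijo f x w (\<gamma>\<^sub>0 / 3 ^ l))"

(* e k is the basis chosen at step k; it is unconstrained once a critical point has been reached. *)
definition nqn_sequence ::
  "(real^'n \<Rightarrow> real) \<Rightarrow> (nat \<Rightarrow> real) \<Rightarrow> real \<Rightarrow> real \<Rightarrow> (nat \<Rightarrow> 'n \<Rightarrow> real^'n) \<Rightarrow> (nat \<Rightarrow> real^'n) \<Rightarrow> bool" where
  "nqn_sequence f \<delta> \<tau> \<gamma>\<^sub>0 e x \<longleftrightarrow>
     (\<forall>k. if gradient f (x k) = 0 then x (Suc k) = x k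
          else orthonormal_basis (e k) \<and>
               (let w = nqn_w_hat f \<delta> \<tau> (e k) (x k)
                in x (Suc k) = x k - armijo_step f \<gamma>\<^sub>0 (x k) w *\<^sub>R w))"

(* min / max of norm (A_k e_{i,k}) over the i with <grad f (x_k), e_{i,k}> nonzero. This index set is
   nonempty iff grad f (x_k) is nonzero. *)
definition nqn_ratio :: "(real^'n \<Rightarrow> real) \<Rightarrow> (nat \<Rightarrow> real) \<Rightarrow> real \<Rightarrow> ('n \<Rightarrow> real^'n) \<Rightarrow> real^'n \<Rightarrow> real" where
  "nqn_ratio f \<delta> \<tau> e x =
     (let \<Lambda> = {i. gradient f x \<bullet> e i \<noteq> 0}
      in (MIN i\<in>\<Lambda>. norm (nqn_matrix f \<delta> \<tau> x *v e i)) / (MAX i\<in>\<Lambda>. norm (nqn_matrix f \<delta> \<tau> x *v e i)))"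

definition diverges_or_converges_critical :: "('a::real_inner \<Rightarrow> real) \<Rightarrow> (nat \<Rightarrow> 'a) \<Rightarrow> bool" where
  "diverges_or_converges_critical f x \<longleftrightarrow>
     filterlim (\<lambda>n. norm (x n)) at_top sequentially \<or>
     (\<exists>z. critical_point f z \<and> x \<longlonglongrightarrow> z)"

end

theory Submission
  imports Defs
begin

text \<open>
  Each of the \<open>m + 1\<close> shifts is rejected only if the Hessian has an eigenvalue close to minus that
  shift, and these eigenvalues are distinct; so some shift is accepted, and the numbers
  \<open>\<parallel>A\<^sub>k e\<^sub>i\<parallel>\<close> lie between \<open>\<kappa> \<parallel>\<nabla>f\<parallel>\<^sup>\<tau>\<close> and a local
  bound. Hence the cosine of the angle between \<open>w\<close> and \<open>\<nabla>f\<close> is at least of order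
  \<open>\<parallel>\<nabla>f\<parallel>\<^bsup>\<tau>/2\<^esup>\<close>, and bounded below if the ratios in part 3 are. By Armijo's
  condition a step of length \<open>d\<close> decreases \<open>f\<close> by at least a multiple of
  \<open>d \<parallel>\<nabla>f\<parallel>\<^bsup>1+\<tau>/2\<^esup>\<close> (respectively \<open>d \<parallel>\<nabla>f\<parallel>\<close>), and
  Lojasiewicz's inequality turns this into a telescoping bound on the path length near any cluster
  point. For part 1, Lojasiewicz's inequality for \<open>\<nabla>f\<close> gives
  \<open>\<bar>\<langle>\<nabla>f, e\<^sub>i\<rangle>\<bar>\<^sup>\<mu> \<le> C \<parallel>A\<^sub>k e\<^sub>i\<parallel>\<close> near a critical point, so that \<open>w\<^sub>k\<close> tends to zero
  along every convergent subsequence; a sequence with this property whose cluster points form a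
  countable set cannot have more than one of them.
\<close>

section \<open>Self-adjoint operators\<close>

text \<open>By minimality \<open>e\<close> lies in the kernel of T^2 - s^2 = (T - s)(T + s), where s
  = \<open>norm (T e)\<close>. So T e + s e is an eigenvector for s unless it vanishes, and then
  \<open>e\<close> itself is one for -s.\<close>

lemma selfadjoint_min_norm_eigenvector:
  fixes T :: "'a::euclidean_space \<Rightarrow> 'a"
  assumes T: "linear T" and adj: "\<And>v w. T v \<bullet> w = v \<bullet> T w"
    and e: "norm e = 1" and min: "\<And>v. norm v = 1 \<Longrightarrow> norm (T e) \<le> norm (T v)"
  obtains \<mu> u where "u \<noteq> 0" "T u = \<mu> *\<^sub>R u" "\<bar>\<mu>\<bar> = norm (T e)"
proof -
  define s where "s = norm (T e)"
  interpret linear T by (rule T)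
  define q where "q v = T v \<bullet> T v - s\<^sup>2 * (v \<bullet> v)" for v
  have q_nonneg: "0 \<le> q v" for v
  proof (cases "v = 0")
    case False
    have "s \<le> norm (T (v /\<^sub>R norm v))"
      unfolding s_def using False by (intro min) simp
    then have "s * norm v \<le> norm (T v)"
      using False by (simp add: scale field_simps)
    then have "(s * norm v)\<^sup>2 \<le> (norm (T v))\<^sup>2"
      by (rule power_mono) (simp add: s_def)
    then show ?thesis
      by (simp add: q_def power_mult_distrib dot_square_norm)
  qed (simp add: q_def)
  have q_e: "q e = 0"
    using e by (simp add: q_def s_def dot_square_norm)
  define r where "r = T (T e) - s\<^sup>2 *\<^sub>R e"
  \<comment> \<open>The nonnegative form \<open>q\<close> vanishes at \<open>e\<close>, so \<open>e\<close> lies in its kernel.\<close>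
  have r_0: "r = 0"
  proof (rule ccontr)
    assume "r \<noteq> 0"
    \<comment> \<open>Along e - t r the first-order term -2 t (r, r) has to beat t^2
      \<open>q r\<close>. This \<open>t\<close> achieves that, and the added 1 keeps the denominator
      positive when \<open>q r\<close> is 0.\<close>
    define t where "t = (r \<bullet> r) / (q r + 1)"
    have t: "0 < t"
      using \<open>r \<noteq> 0\<close> q_nonneg[of r] unfolding t_def by (intro divide_pos_pos) auto
    have rr: "r \<bullet> r = T e \<bullet> T r - s\<^sup>2 * (e \<bullet> r)"
      using adj[of "T e" r] by (subst (1) r_def) (simp add: inner_diff_left)
    have "q (e - t *\<^sub>R r) = q e - 2 * t * (T e \<bullet> T r - s\<^sup>2 * (e \<bullet> r)) + t\<^sup>2 * q r"
      unfolding q_def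
      by (simp add: diff scale inner_diff_left inner_diff_right inner_commute
          power2_eq_square algebra_simps)
    also have "\<dots> = t * (- 2 * (r \<bullet> r) + t * q r)"
      unfolding rr[symmetric] by (simp add: q_e power2_eq_square algebra_simps)
    also have "t * q r \<le> r \<bullet> r"
      using q_nonneg[of r] by (simp add: t_def divide_simps mult_left_mono)
    finally have "q (e - t *\<^sub>R r) \<le> t * (- (r \<bullet> r))"
      using t by (simp add: mult_left_mono)
    moreover have "t * (- (r \<bullet> r)) < 0"
      using t \<open>r \<noteq> 0\<close> by (simp add: mult_pos_pos)
    ultimately show False using q_nonneg[of "e - t *\<^sub>R r"] by linarith
  qed
  define u where "u = T e + s *\<^sub>R e"
  show thesis
  proof (cases "u = 0")
    case True
    then have "T e = (- s) *\<^sub>R e"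
      by (simp add: u_def eq_neg_iff_add_eq_0)
    then show thesis
      using that[of e "- s"] e by (fastforce simp: s_def)
  next
    case False
    have "T u = s *\<^sub>R u"
      using r_0 by (simp add: u_def r_def add scale algebra_simps power2_eq_square)
    then show thesis
      using that[of u s] False by (auto simp: s_def)
  qed
qed

text \<open>A rejected shift yields an eigenvalue of \<open>T\<close> within \<open>c\<close> of
  \<open>- d j\<close>. Gaps of at least \<open>2 * c\<close> keep these eigenvalues distinct, so
  their eigenvectors are orthogonal, and \<open>DIM('a)\<close> + 1 of them do not fit into the
  space.\<close>

lemma selfadjoint_exists_good_shift:
  fixes T :: "'a::euclidean_space \<Rightarrow> 'a" and d :: "nat \<Rightarrow> real"
  assumes T: "linear T" and adj: "\<And>v w. T v \<bullet> w = v \<bullet> T w"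
    and gap: "\<And>i j. i \<le> DIM('a) \<Longrightarrow> j \<le> DIM('a) \<Longrightarrow> i \<noteq> j \<Longrightarrow> 2 * c \<le> \<bar>d i - d j\<bar>"
  shows "\<exists>j\<le>DIM('a). \<forall>v. norm v = 1 \<longrightarrow> c \<le> norm (T v + d j *\<^sub>R v)"
proof (rule ccontr)
  assume bad: "\<not> ?thesis"
  interpret linear T by (rule T)
  have "\<exists>u \<mu>. u \<noteq> 0 \<and> T u + d j *\<^sub>R u = \<mu> *\<^sub>R u \<and> \<bar>\<mu>\<bar> < c" if j: "j \<le> DIM('a)" for j
  proof -
    let ?S = "\<lambda>v. T v + d j *\<^sub>R v"
    obtain v where v: "norm v = 1" "norm (?S v) < c"
      using bad j by (metis not_le)
    have "continuous_on (sphere 0 1) (\<lambda>v. norm (?S v))"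
      using linear_continuous_on[OF linear_conv_bounded_linear[THEN iffD1, OF T]]
      by (intro continuous_intros)
    moreover have "sphere (0::'a) 1 \<noteq> {}" by simp
    ultimately obtain e where e: "norm e = 1" "\<And>v. norm v = 1 \<Longrightarrow> norm (?S e) \<le> norm (?S v)"
      using continuous_attains_inf[OF compact_sphere, of 0 1 "\<lambda>v. norm (?S v)"] by auto
    have "linear ?S"
      using T by (intro linear_compose_add linear_scaleR) auto
    moreover have "?S v \<bullet> w = v \<bullet> ?S w" for v w
      using adj by (simp add: inner_add_left inner_add_right)
    ultimately obtain \<mu> u where "u \<noteq> 0" "?S u = \<mu> *\<^sub>R u" "\<bar>\<mu>\<bar> = norm (?S e)"
      using selfadjoint_min_norm_eigenvector[where T = ?S and e = e] e by blast
    then show ?thesis using e(2)[OF v(1)] v(2) by force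
  qed
  then obtain u \<mu> where u: "\<And>j. j \<le> DIM('a) \<Longrightarrow> u j \<noteq> 0"
      "\<And>j. j \<le> DIM('a) \<Longrightarrow> T (u j) + d j *\<^sub>R u j = \<mu> j *\<^sub>R u j"
      "\<And>j. j \<le> DIM('a) \<Longrightarrow> \<bar>\<mu> j\<bar> < c"
    by metis
  have eig: "T (u j) = (\<mu> j - d j) *\<^sub>R u j" if "j \<le> DIM('a)" for j
    using u(2)[OF that] by (simp add: algebra_simps)
  have orth: "u i \<bullet> u j = 0" if "i \<le> DIM('a)" "j \<le> DIM('a)" "i \<noteq> j" for i j
  proof -
    have "(\<mu> i - d i) * (u i \<bullet> u j) = (\<mu> j - d j) * (u i \<bullet> u j)"
      using adj[of "u i" "u j"] that by (simp add: eig)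
    moreover have "\<mu> i - d i \<noteq> \<mu> j - d j"
      using gap[OF that] u(3)[OF that(1)] u(3)[OF that(2)] by linarith
    ultimately show ?thesis by simp
  qed
  let ?U = "u ` {..DIM('a)}"
  have inj: "inj_on u {..DIM('a)}"
    by (rule inj_onI) (metis atMost_iff inner_eq_zero_iff orth u(1))
  have "pairwise orthogonal ?U"
    by (auto simp: pairwise_def orthogonal_def intro: orth)
  moreover have "0 \<notin> ?U" using u(1) by force
  ultimately have "card ?U \<le> DIM('a)"
    using independent_bound pairwise_orthogonal_independent by blast
  then show False using inj by (simp add: card_image)
qed

text \<open>The norm of a matrix is here the Frobenius norm, so Cauchy-Schwarz on each row
  suffices.\<close>

lemma norm_matrix_vector_mult_le:
  fixes A :: "real^'n^'m"
  shows "norm (A *v v) \<le> norm A * norm v"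
proof -
  have "norm (A *v v) \<le> L2_set (\<lambda>i. norm (A $ i) * norm v) UNIV"
    unfolding norm_vec_def[of "A *v v"]
    by (rule L2_set_mono) (auto simp: matrix_vector_mul_component Cauchy_Schwarz_ineq2)
  also have "\<dots> = norm A * norm v"
    by (simp add: norm_vec_def[of A] L2_set_left_distrib)
  finally show ?thesis .
qed

section \<open>Gradient and Hessian of a C2 function\<close>

text \<open>The derivative is a linear functional and is represented by the vector
  \<open>adjoint D 1\<close>; uniqueness then identifies this vector with
  \<open>gradient f x\<close>.\<close>

lemma differentiable_GDERIV:
  fixes f :: "'a::euclidean_space \<Rightarrow> real"
  assumes "f differentiable (at x)"
  shows "GDERIV f x :> gradient f x"
proof -
  obtain D where D: "(f has_derivative D) (at x)"
    using assms unfolding differentiable_def by blast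
  then have "linear D" by (rule has_derivative_linear)
  then have "D = (\<lambda>h. h \<bullet> adjoint D 1)"
    by (simp add: fun_eq_iff adjoint_works)
  then have "GDERIV f x :> adjoint D 1"
    using D unfolding gderiv_def by simp
  then show ?thesis using gradient_eqI by metis
qed

lemma GDERIV_along_line:
  assumes "GDERIV f (x + t *\<^sub>R v) :> D"
  shows "((\<lambda>t. f (x + t *\<^sub>R v)) has_real_derivative D \<bullet> v) (at t)"
proof -
  have f: "(f has_derivative (\<lambda>h. h \<bullet> D)) (at (x + t *\<^sub>R v))"
    using assms by (simp add: gderiv_def)
  have "((\<lambda>t. x + t *\<^sub>R v) has_derivative (\<lambda>h. h *\<^sub>R v)) (at t)"
    by (auto intro!: derivative_eq_intros)
  from has_derivative_compose[OF this f] show ?thesis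
    by (simp add: has_field_derivative_def mult.commute[of _ "D \<bullet> v"] inner_commute)
qed

text \<open>The mean value theorem turns the second difference into \<open>t\<close> times a
  difference of gradients paired with \<open>h\<close>. Differentiability of \<open>g\<close> at
  \<open>x\<close> replaces that difference by t H k up to an error of order \<epsilon> t.\<close>

lemma GDERIV_second_difference:
  assumes f: "\<And>y. GDERIV f y :> g y"
    and g: "(g has_derivative H) (at x)" and "0 < \<epsilon>"
  obtains \<eta> where "0 < \<eta>"
    "\<And>t. 0 < t \<Longrightarrow> t < \<eta> \<Longrightarrow>
      \<bar>f (x + t *\<^sub>R (h + k)) - f (x + t *\<^sub>R h) - f (x + t *\<^sub>R k) + f x - t\<^sup>2 * (H k \<bullet> h)\<bar>
        \<le> 2 * \<epsilon> * t\<^sup>2 * (norm h + norm k)\<^sup>2"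
proof -
  interpret H: bounded_linear H using g by (rule has_derivative_bounded_linear)
  obtain d where d: "0 < d"
    "\<And>y. norm (y - x) < d \<Longrightarrow> norm (g y - g x - H (y - x)) \<le> \<epsilon> * norm (y - x)"
    using g \<open>0 < \<epsilon>\<close> unfolding has_derivative_at_alt by blast
  define \<eta> where "\<eta> = d / (norm h + norm k + 1)"
  have p: "0 < norm h + norm k + 1"
    using norm_ge_zero[of h] norm_ge_zero[of k] by linarith
  show thesis
  proof
    show "0 < \<eta>" using d p by (simp add: \<eta>_def)
    fix t :: real assume t: "0 < t" "t < \<eta>"
    define u where "u s = f ((x + t *\<^sub>R k) + s *\<^sub>R h) - f (x + s *\<^sub>R h)" for s
    define u' where "u' s = g ((x + t *\<^sub>R k) + s *\<^sub>R h) \<bullet> h - g (x + s *\<^sub>R h) \<bullet> h" for s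
    have "(u has_real_derivative u' s) (at s)" for s
      unfolding u_def u'_def by (intro DERIV_diff GDERIV_along_line f)
    then obtain s where s: "0 < s" "s < t" and us: "u t - u 0 = (t - 0) * u' s"
      using MVT2[OF t(1), of u u'] by blast
    have small: "norm (s *\<^sub>R h + c *\<^sub>R k) \<le> t * (norm h + norm k)" if "0 \<le> c" "c \<le> t" for c
    proof -
      have "norm (s *\<^sub>R h + c *\<^sub>R k) \<le> s * norm h + c * norm k"
        using norm_triangle_ineq[of "s *\<^sub>R h" "c *\<^sub>R k"] s that by simp
      also have "\<dots> \<le> t * norm h + t * norm k"
        using s that by (intro add_mono mult_right_mono) auto
      finally show ?thesis by (simp add: algebra_simps)
    qed
    have err: "norm (g (x + (s *\<^sub>R h + c *\<^sub>R k)) - g x - H (s *\<^sub>R h + c *\<^sub>R k))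
        \<le> \<epsilon> * (t * (norm h + norm k))" if "0 \<le> c" "c \<le> t" for c
    proof -
      have "t * (norm h + norm k) \<le> t * (norm h + norm k + 1)"
        using t by (intro mult_left_mono) auto
      also have "\<dots> < d"
        using t p by (simp add: \<eta>_def field_simps)
      finally have "norm (s *\<^sub>R h + c *\<^sub>R k) < d"
        using small[OF that] by linarith
      then have "norm (g (x + (s *\<^sub>R h + c *\<^sub>R k)) - g x - H (s *\<^sub>R h + c *\<^sub>R k))
          \<le> \<epsilon> * norm (s *\<^sub>R h + c *\<^sub>R k)"
        using d(2)[of "x + (s *\<^sub>R h + c *\<^sub>R k)"] by simp
      also have "\<dots> \<le> \<epsilon> * (t * (norm h + norm k))"
        using small[OF that] \<open>0 < \<epsilon>\<close> by (intro mult_left_mono) auto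
      finally show ?thesis .
    qed
    \<comment> \<open>\<open>?E c\<close> is the linearisation error at the offset s h + c k. In
      \<open>?E t - ?E 0\<close> the terms \<open>g x\<close> and H (s h) cancel, which leaves only
      t H k beside the two gradients.\<close>
    let ?E = "\<lambda>c. g (x + (s *\<^sub>R h + c *\<^sub>R k)) - g x - H (s *\<^sub>R h + c *\<^sub>R k)"
    have "?E t - ?E 0 = g (x + t *\<^sub>R k + s *\<^sub>R h) - g (x + s *\<^sub>R h) - t *\<^sub>R H k"
      by (simp add: H.add H.scaleR algebra_simps)
    then have "(?E t - ?E 0) \<bullet> h = u' s - t * (H k \<bullet> h)"
      by (simp only: u'_def) (simp add: inner_diff_left)
    then have "\<bar>u' s - t * (H k \<bullet> h)\<bar> \<le> norm (?E t - ?E 0) * norm h"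
      using Cauchy_Schwarz_ineq2[of "?E t - ?E 0" h] by (simp only:)
    also have "\<dots> \<le> (2 * \<epsilon> * (t * (norm h + norm k))) * norm h"
      using err[of t] err[of 0] t norm_triangle_ineq4[of "?E t" "?E 0"]
      by (intro mult_right_mono) auto
    also have "\<dots> \<le> (2 * \<epsilon> * (t * (norm h + norm k))) * (norm h + norm k)"
      using t \<open>0 < \<epsilon>\<close> by (intro mult_left_mono mult_nonneg_nonneg) auto
    finally have *: "\<bar>u' s - t * (H k \<bullet> h)\<bar> \<le> 2 * \<epsilon> * t * (norm h + norm k)\<^sup>2"
      by (simp add: power2_eq_square algebra_simps)
    have "f (x + t *\<^sub>R (h + k)) - f (x + t *\<^sub>R h) - f (x + t *\<^sub>R k) + f x - t\<^sup>2 * (H k \<bullet> h)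
        = t * (u' s - t * (H k \<bullet> h))"
      using us by (simp add: u_def algebra_simps power2_eq_square)
    then have "\<bar>f (x + t *\<^sub>R (h + k)) - f (x + t *\<^sub>R h) - f (x + t *\<^sub>R k) + f x - t\<^sup>2 * (H k \<bullet> h)\<bar>
        = t * \<bar>u' s - t * (H k \<bullet> h)\<bar>"
      using t by (simp add: abs_mult)
    also have "\<dots> \<le> t * (2 * \<epsilon> * t * (norm h + norm k)\<^sup>2)"
      using * t by (intro mult_left_mono) auto
    finally show "\<bar>f (x + t *\<^sub>R (h + k)) - f (x + t *\<^sub>R h) - f (x + t *\<^sub>R k) + f x
        - t\<^sup>2 * (H k \<bullet> h)\<bar> \<le> 2 * \<epsilon> * t\<^sup>2 * (norm h + norm k)\<^sup>2"
      by (simp add: power2_eq_square algebra_simps)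
  qed
qed

text \<open>The second difference is symmetric in \<open>h\<close> and \<open>k\<close>, yet divided
  by t^2 it tends both to \<open>H k \<bullet> h\<close> and to
  \<open>H h \<bullet> k\<close>.\<close>

lemma GDERIV_second_derivative_symmetric:
  assumes f: "\<And>y. GDERIV f y :> g y" and g: "(g has_derivative H) (at x)"
  shows "H h \<bullet> k = h \<bullet> H k"
proof -
  have "\<bar>H k \<bullet> h - H h \<bullet> k\<bar> \<le> 4 * (norm h + norm k)\<^sup>2 * \<epsilon>" if \<epsilon>: "0 < \<epsilon>" for \<epsilon>
  proof -
    obtain \<eta>1 where \<eta>1: "0 < \<eta>1"
      "\<And>t. 0 < t \<Longrightarrow> t < \<eta>1 \<Longrightarrow>
        \<bar>f (x + t *\<^sub>R (h + k)) - f (x + t *\<^sub>R h) - f (x + t *\<^sub>R k) + f x - t\<^sup>2 * (H k \<bullet> h)\<bar>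
        \<le> 2 * \<epsilon> * t\<^sup>2 * (norm h + norm k)\<^sup>2"
      using GDERIV_second_difference[where f = f and g = g, OF f g \<epsilon>] by blast
    obtain \<eta>2 where \<eta>2: "0 < \<eta>2"
      "\<And>t. 0 < t \<Longrightarrow> t < \<eta>2 \<Longrightarrow>
        \<bar>f (x + t *\<^sub>R (k + h)) - f (x + t *\<^sub>R k) - f (x + t *\<^sub>R h) + f x - t\<^sup>2 * (H h \<bullet> k)\<bar>
        \<le> 2 * \<epsilon> * t\<^sup>2 * (norm k + norm h)\<^sup>2"
      using GDERIV_second_difference[where f = f and g = g, OF f g \<epsilon>] by blast
    define t where "t = min \<eta>1 \<eta>2 / 2"
    have t: "0 < t" "t < \<eta>1" "t < \<eta>2" using \<eta>1(1) \<eta>2(1) by (auto simp: t_def)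
    have "\<bar>t\<^sup>2 * (H k \<bullet> h) - t\<^sup>2 * (H h \<bullet> k)\<bar> \<le> 4 * \<epsilon> * t\<^sup>2 * (norm h + norm k)\<^sup>2"
      using \<eta>1(2)[OF t(1,2)] \<eta>2(2)[OF t(1,3)]
      unfolding add.commute[of k h] add.commute[of "norm k" "norm h"] by linarith
    then have "t\<^sup>2 * \<bar>H k \<bullet> h - H h \<bullet> k\<bar> \<le> t\<^sup>2 * (4 * (norm h + norm k)\<^sup>2 * \<epsilon>)"
      by (simp add: abs_mult flip: right_diff_distrib) (simp add: algebra_simps)
    then show ?thesis using t by simp
  qed
  note bound = this
  have "\<bar>H k \<bullet> h - H h \<bullet> k\<bar> \<le> 0 + \<epsilon>" if "0 < \<epsilon>" for \<epsilon>
  proof -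
    let ?K = "4 * (norm h + norm k)\<^sup>2"
    \<comment> \<open>The added 1 covers the case \<open>?K\<close> = 0, which occurs for h = k =
      0.\<close>
    have "\<bar>H k \<bullet> h - H h \<bullet> k\<bar> \<le> ?K * (\<epsilon> / (?K + 1))"
      using that by (intro bound divide_pos_pos) (auto intro: add_nonneg_pos)
    also have "\<dots> \<le> \<epsilon>"
      using that by (simp add: divide_simps add_nonneg_pos)
    finally show ?thesis by simp
  qed
  then have "\<bar>H k \<bullet> h - H h \<bullet> k\<bar> \<le> 0"
    by (rule field_le_epsilon)
  then show ?thesis by (simp add: inner_commute)
qed

lemma C2_function_GDERIV:
  "C2_function f \<Longrightarrow> GDERIV f x :> gradient f x"
  unfolding C2_function_def differentiable_on_def by (simp add: differentiable_GDERIV)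

lemma C2_function_gradient_has_derivative:
  "C2_function f \<Longrightarrow> (gradient f has_derivative (\<lambda>h. hessian f x *v h)) (at x)"
  unfolding C2_function_def differentiable_on_def hessian_def
  by (simp add: jacobian_works[symmetric])

lemma C2_function_hessian_symmetric:
  "C2_function f \<Longrightarrow> (hessian f x *v h) \<bullet> k = h \<bullet> (hessian f x *v k)"
  by (rule GDERIV_second_derivative_symmetric)
     (auto intro: C2_function_GDERIV C2_function_gradient_has_derivative)

lemma C2_function_isCont:
  assumes "C2_function f"
  shows "isCont f x" "isCont (gradient f) x" "isCont (hessian f) x"
  using assms C2_function_GDERIV[OF assms, of x]
    C2_function_gradient_has_derivative[OF assms, of x]
  by (auto simp: C2_function_def gderiv_def continuous_on_eq_continuous_at
      intro: has_derivative_continuous)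

section \<open>Rescaling the coordinates of a vector\<close>

text \<open>The remainder is orthogonal to every basis vector, hence to their span, hence to
  itself.\<close>

lemma orthonormal_basis_expansion:
  assumes "orthonormal_basis e"
  shows "v = (\<Sum>i\<in>UNIV. (v \<bullet> e i) *\<^sub>R e i)"
proof -
  define d where "d = v - (\<Sum>i\<in>UNIV. (v \<bullet> e i) *\<^sub>R e i)"
  have "d \<bullet> e j = 0" for j
  proof -
    have "(\<Sum>i\<in>UNIV. (v \<bullet> e i) *\<^sub>R e i) \<bullet> e j = (\<Sum>i\<in>UNIV. if i = j then v \<bullet> e i else 0)"
      unfolding inner_sum_left
      using assms by (intro sum.cong) (auto simp: orthonormal_basis_def)
    then show ?thesis by (simp add: d_def inner_diff_left)
  qed
  then have "orthogonal d d"
    using assms by (intro orthogonal_to_span[of d "range e"])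
      (auto simp: orthonormal_basis_def orthogonal_def)
  then show ?thesis by (simp add: d_def orthogonal_def)
qed

lemma orthonormal_basis_inner:
  assumes "orthonormal_basis e"
  shows "v \<bullet> u = (\<Sum>i\<in>UNIV. (v \<bullet> e i) * (u \<bullet> e i))"
proof -
  have "v \<bullet> u = (\<Sum>i\<in>UNIV. (v \<bullet> e i) *\<^sub>R e i) \<bullet> u"
    by (subst (1) orthonormal_basis_expansion[OF assms, of v]) (rule refl)
  then show ?thesis by (simp add: inner_sum_left inner_commute[of u])
qed

lemma orthonormal_basis_norm:
  "orthonormal_basis e \<Longrightarrow> norm (e i) = 1"
  by (simp add: orthonormal_basis_def norm_eq_sqrt_inner)

text \<open>The coordinates of \<open>w\<close> are those of \<open>g\<close> divided by
  \<open>l i\<close>, so lo w_i^2 \<le> w_i g_i and g_i^2 \<le> hi w_i g_i. Summing each and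
  multiplying the sums bounds the cosine of the angle. \<open>l i\<close> is constrained only where
  \<open>g\<close> has a nonzero coordinate, since part 3 controls only those indices.\<close>

lemma rescaled_vector_bounds:
  fixes e :: "'n::finite \<Rightarrow> real^'n"
  assumes e: "orthonormal_basis e" and lo: "0 < lo" "lo \<le> hi"
    and l: "\<And>i. g \<bullet> e i \<noteq> 0 \<Longrightarrow> lo \<le> l i \<and> l i \<le> hi"
    and w: "w = (\<Sum>i\<in>UNIV. (g \<bullet> e i / l i) *\<^sub>R e i)"
  shows "norm g \<le> hi * norm w" and "sqrt (lo / hi) * (norm w * norm g) \<le> w \<bullet> g"
proof -
  have we: "w \<bullet> e j = g \<bullet> e j / l j" for j
  proof -
    have "w \<bullet> e j = (\<Sum>i\<in>UNIV. if i = j then g \<bullet> e i / l i else 0)"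
      unfolding w inner_sum_left
      using e by (intro sum.cong) (auto simp: orthonormal_basis_def)
    then show ?thesis by simp
  qed
  have "lo * (w \<bullet> w) \<le> w \<bullet> g"
    unfolding orthonormal_basis_inner[OF e, of w w] orthonormal_basis_inner[OF e, of w g] sum_distrib_left
  proof (rule sum_mono)
    fix i
    show "lo * (w \<bullet> e i * (w \<bullet> e i)) \<le> w \<bullet> e i * (g \<bullet> e i)"
    proof (cases "g \<bullet> e i = 0")
      case False
      then have "lo \<le> l i" "0 < l i" using l[OF False] lo(1) by linarith+
      then have "lo * (w \<bullet> e i * (w \<bullet> e i)) \<le> l i * (w \<bullet> e i * (w \<bullet> e i))"
        by (intro mult_right_mono) auto
      also have "\<dots> = w \<bullet> e i * (g \<bullet> e i)"
        using \<open>0 < l i\<close> by (simp add: we)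
      finally show ?thesis .
    qed (simp add: we)
  qed
  then have wg1: "lo * (norm w)\<^sup>2 \<le> w \<bullet> g" by (simp add: dot_square_norm)
  have "g \<bullet> g \<le> hi * (w \<bullet> g)"
    unfolding orthonormal_basis_inner[OF e, of g g] orthonormal_basis_inner[OF e, of w g] sum_distrib_left
  proof (rule sum_mono)
    fix i
    show "g \<bullet> e i * (g \<bullet> e i) \<le> hi * (w \<bullet> e i * (g \<bullet> e i))"
    proof (cases "g \<bullet> e i = 0")
      case False
      then have "l i \<le> hi" "0 < l i" using l[OF False] lo(1) by linarith+
      then have "l i * (w \<bullet> e i * (g \<bullet> e i)) \<le> hi * (w \<bullet> e i * (g \<bullet> e i))"
        by (intro mult_right_mono) (auto simp: we)
      moreover have "l i * (w \<bullet> e i * (g \<bullet> e i)) = g \<bullet> e i * (g \<bullet> e i)"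
        using \<open>0 < l i\<close> by (simp add: we)
      ultimately show ?thesis by simp
    qed simp
  qed
  then have wg2: "(norm g)\<^sup>2 \<le> hi * (w \<bullet> g)" by (simp add: dot_square_norm)
  have wg_nonneg: "0 \<le> w \<bullet> g"
    using order_trans[OF _ wg1, of 0] lo by simp
  show "norm g \<le> hi * norm w"
  proof (cases "g = 0")
    case False
    have "norm g * norm g \<le> hi * (w \<bullet> g)"
      using wg2 by (simp only: power2_eq_square)
    also have "\<dots> \<le> hi * (norm w * norm g)"
      using lo by (intro mult_left_mono norm_cauchy_schwarz) linarith
    finally have "norm g * norm g \<le> (hi * norm w) * norm g" by (simp only: mult.assoc)
    then show ?thesis
      using False by (intro mult_right_le_imp_le[of "norm g" "norm g"]) simp_all
  qed (use lo in simp)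
  have "lo * (norm w)\<^sup>2 * (norm g)\<^sup>2 \<le> (w \<bullet> g) * (hi * (w \<bullet> g))"
    using wg_nonneg by (rule mult_mono[OF wg1 wg2]) simp
  then have "lo / hi * ((norm w)\<^sup>2 * (norm g)\<^sup>2) \<le> (w \<bullet> g)\<^sup>2"
    using lo by (simp add: divide_le_eq power2_eq_square mult_ac)
  moreover have "(sqrt (lo / hi))\<^sup>2 = lo / hi"
    using lo by (intro real_sqrt_pow2) simp
  ultimately have "(sqrt (lo / hi) * (norm w * norm g))\<^sup>2 \<le> (w \<bullet> g)\<^sup>2"
    by (simp only: power_mult_distrib)
  then show "sqrt (lo / hi) * (norm w * norm g) \<le> w \<bullet> g"
    using wg_nonneg by (rule power2_le_imp_le)
qed

section \<open>Armijo's condition\<close>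

text \<open>By the mean value theorem the decrease is \<gamma> times the inner product of
  \<open>w\<close> with a nearby gradient. If the gradient has moved by at most 2/3 of
  \<open>w \<bullet> gradient f x\<close>, the remaining third is what Armijo's condition asks
  for.\<close>

lemma armijo_small_step:
  assumes f: "\<And>y. GDERIV f y :> gradient f y" and w: "norm w \<le> 1"
    and \<eta>: "\<And>y. dist y x \<le> \<eta> \<Longrightarrow> dist (gradient f y) (gradient f x) \<le> 2/3 * (w \<bullet> gradient f x)"
    and \<gamma>: "0 < \<gamma>" "\<gamma> \<le> \<eta>"
  shows "armijo f x w \<gamma>"
proof -
  define u where "u t = f (x + t *\<^sub>R (- w))" for t
  have "(u has_real_derivative gradient f (x + t *\<^sub>R (- w)) \<bullet> (- w)) (at t)" for t
    unfolding u_def by (intro GDERIV_along_line f)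
  then obtain s where s: "0 < s" "s < \<gamma>"
      and us: "u \<gamma> - u 0 = (\<gamma> - 0) * (gradient f (x + s *\<^sub>R (- w)) \<bullet> (- w))"
    using MVT2[OF \<gamma>(1), of u "\<lambda>t. gradient f (x + t *\<^sub>R (- w)) \<bullet> (- w)"] by blast
  let ?y = "x + s *\<^sub>R (- w)"
  have "s * norm w \<le> \<eta> * 1"
    using s \<gamma> w by (intro mult_mono) auto
  then have "dist ?y x \<le> \<eta>" using s by (simp add: dist_norm)
  note d = \<eta>[OF this]
  have "(gradient f x - gradient f ?y) \<bullet> w \<le> norm (gradient f x - gradient f ?y) * norm w"
    by (rule norm_cauchy_schwarz)
  also have "\<dots> \<le> norm (gradient f x - gradient f ?y)"
    using w by (simp add: mult_left_le)
  also have "\<dots> \<le> 2/3 * (w \<bullet> gradient f x)"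
    using d by (simp add: dist_norm norm_minus_commute)
  finally have "gradient f ?y \<bullet> (- w) \<le> - (1/3) * (w \<bullet> gradient f x)"
    by (simp add: inner_diff_left inner_commute[of w])
  then have "u \<gamma> - u 0 \<le> \<gamma> * (- (1/3) * (w \<bullet> gradient f x))"
    unfolding us using \<gamma> by (simp add: mult_left_mono)
  then show ?thesis by (simp add: armijo_def u_def)
qed

text \<open>If the first accepted trial is not the initial one, the trial before it, three times as
  long, was rejected and hence exceeds \<eta>.\<close>

lemma armijo_step_bounds:
  assumes "0 < \<gamma>\<^sub>0" "0 < \<eta>" and ar: "\<And>\<gamma>. 0 < \<gamma> \<Longrightarrow> \<gamma> \<le> \<eta> \<Longrightarrow> armijo f x w \<gamma>"
  shows "armijo f x w (armijo_step f \<gamma>\<^sub>0 x w)"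
    and "min \<gamma>\<^sub>0 (\<eta> / 3) \<le> armijo_step f \<gamma>\<^sub>0 x w" and "armijo_step f \<gamma>\<^sub>0 x w \<le> \<gamma>\<^sub>0"
proof -
  let ?P = "\<lambda>l. armijo f x w (\<gamma>\<^sub>0 / 3 ^ l)"
  obtain l where "(1/3) ^ l < \<eta> / \<gamma>\<^sub>0"
    using real_arch_pow_inv[of "\<eta> / \<gamma>\<^sub>0" "1/3"] assms(1,2) by auto
  then have "\<gamma>\<^sub>0 / 3 ^ l \<le> \<eta>" "0 < \<gamma>\<^sub>0 / 3 ^ l"
    using assms(1,2) by (simp_all add: field_simps power_divide)
  then have "?P l" by (intro ar)
  then show "armijo f x w (armijo_step f \<gamma>\<^sub>0 x w)"
    unfolding armijo_step_def by (rule LeastI)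
  show "armijo_step f \<gamma>\<^sub>0 x w \<le> \<gamma>\<^sub>0"
    unfolding armijo_step_def using assms(1) by (simp add: divide_le_eq)
  show "min \<gamma>\<^sub>0 (\<eta> / 3) \<le> armijo_step f \<gamma>\<^sub>0 x w"
  proof (cases "Least ?P")
    case (Suc n)
    then have "\<not> ?P n" by (intro not_less_Least) simp
    moreover have "0 < \<gamma>\<^sub>0 / 3 ^ n" using assms(1) by simp
    ultimately have "\<not> \<gamma>\<^sub>0 / 3 ^ n \<le> \<eta>" using ar[of "\<gamma>\<^sub>0 / 3 ^ n"] by blast
    then show ?thesis by (simp add: armijo_step_def Suc)
  qed (simp add: armijo_step_def)
qed

section \<open>Convergence from a Lojasiewicz-type estimate\<close>

text \<open>This is concavity of the power 1 - \<theta>, obtained from Young's inequality. It turns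
  a decrease of function values into a decrease of their powers, which telescopes.\<close>

lemma powr_diff_ge:
  fixes a b :: real
  assumes "0 < a" "0 \<le> b" "0 < \<theta>" "\<theta> < 1"
  shows "(1 - \<theta>) * (a - b) \<le> a powr \<theta> * (a powr (1 - \<theta>) - b powr (1 - \<theta>))"
proof -
  have "a powr \<theta> * b powr (1 - \<theta>) \<le> \<theta> * a + (1 - \<theta>) * b"
  proof (cases "b = 0")
    case False
    then show ?thesis using assms by (intro Youngs_inequality_0) auto
  qed (use assms in simp)
  moreover have "a powr \<theta> * a powr (1 - \<theta>) = a"
    using assms by (simp flip: powr_add)
  ultimately show ?thesis by (simp add: algebra_simps)
qed

text \<open>Near \<open>z\<close> each step is at most the decrement of a multiple \<psi> of \<phi>
  to the power 1 - \<theta>. Once the sequence is very close to \<open>z\<close> and \<psi> is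
  small, the total remaining path is too short to leave the ball.\<close>

lemma cluster_point_imp_limit:
  fixes x :: "nat \<Rightarrow> 'a::metric_space" and \<phi> :: "nat \<Rightarrow> real"
  assumes pos: "\<And>k. 0 < \<phi> k" and lim: "\<phi> \<longlonglongrightarrow> 0"
    and \<theta>: "0 < \<theta>" "\<theta> < 1" and "0 < r" "0 \<le> K"
    and step: "\<And>k. dist (x k) z < r \<Longrightarrow>
      dist (x (Suc k)) (x k) * \<phi> k powr \<theta> \<le> K * (\<phi> k - \<phi> (Suc k))"
    and s: "strict_mono s" "(x \<circ> s) \<longlonglongrightarrow> z"
  shows "x \<longlonglongrightarrow> z"
proof -
  \<comment> \<open>Dividing by 1 - \<theta> compensates for the factor in
    \<open>powr_diff_ge\<close>.\<close>
  define c where "c = K / (1 - \<theta>)"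
  have c: "0 \<le> c" "K = c * (1 - \<theta>)"
    using \<theta> \<open>0 \<le> K\<close> by (simp_all add: c_def)
  define \<psi> where "\<psi> k = c * \<phi> k powr (1 - \<theta>)" for k
  have \<psi>_nonneg: "0 \<le> \<psi> k" for k
    using c by (simp add: \<psi>_def)
  have "\<forall>\<^sub>F k in sequentially. 0 \<le> \<phi> k"
    using pos by (intro always_eventually) (simp add: less_imp_le)
  then have "(\<lambda>k. \<phi> k powr (1 - \<theta>)) \<longlonglongrightarrow> 0"
    using \<theta> by (intro tendsto_zero_powrI[OF lim tendsto_const]) auto
  then have "(\<lambda>k. c * \<phi> k powr (1 - \<theta>)) \<longlonglongrightarrow> 0"
    by (rule tendsto_mult_right_zero)
  then have \<psi>_lim: "\<psi> \<longlonglongrightarrow> 0" by (simp only: \<psi>_def[abs_def])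
  have step': "dist (x (Suc k)) (x k) \<le> \<psi> k - \<psi> (Suc k)" if "dist (x k) z < r" for k
  proof -
    have "K * (\<phi> k - \<phi> (Suc k)) = c * ((1 - \<theta>) * (\<phi> k - \<phi> (Suc k)))"
      by (simp only: c(2) mult.assoc)
    also have "\<dots> \<le> c * (\<phi> k powr \<theta> * (\<phi> k powr (1 - \<theta>) - \<phi> (Suc k) powr (1 - \<theta>)))"
      using \<theta> c(1) pos[of k] pos[of "Suc k"]
      by (intro mult_left_mono powr_diff_ge) linarith+
    also have "\<dots> = (\<psi> k - \<psi> (Suc k)) * \<phi> k powr \<theta>"
      unfolding \<psi>_def by (simp only: right_diff_distrib left_diff_distrib mult_ac)
    finally have "dist (x (Suc k)) (x k) * \<phi> k powr \<theta> \<le> (\<psi> k - \<psi> (Suc k)) * \<phi> k powr \<theta>"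
      using step[OF that] by linarith
    then show ?thesis
      by (rule mult_right_le_imp_le) (use pos[of k] in simp)
  qed
  show ?thesis
  proof (rule metric_LIMSEQ_I)
    fix \<epsilon> :: real assume "0 < \<epsilon>"
    define \<rho> where "\<rho> = min \<epsilon> r"
    have \<rho>: "0 < \<rho>" using \<open>0 < \<epsilon>\<close> \<open>0 < r\<close> by (simp add: \<rho>_def)
    have "(\<psi> \<circ> s) \<longlonglongrightarrow> 0"
      using LIMSEQ_subseq_LIMSEQ[OF \<psi>_lim s(1)] .
    then have "\<forall>\<^sub>F n in sequentially. \<psi> (s n) < \<rho> / 2"
      using order_tendstoD(2)[of "\<psi> \<circ> s" 0 sequentially "\<rho> / 2"] \<rho> by simp
    moreover have "\<forall>\<^sub>F n in sequentially. dist (x (s n)) z < \<rho> / 2"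
      using tendstoD[OF s(2), of "\<rho> / 2"] \<rho> by simp
    ultimately have "\<forall>\<^sub>F n in sequentially. \<psi> (s n) < \<rho> / 2 \<and> dist (x (s n)) z < \<rho> / 2"
      by eventually_elim auto
    then obtain N where N: "\<psi> N < \<rho> / 2" "dist (x N) z < \<rho> / 2"
      using eventually_happens[of _ sequentially] by auto
    \<comment> \<open>The sum of the distance to \<open>z\<close> and \<psi> does not increase as
      long as the point lies in the ball of radius \<open>r\<close>, and a sum below \<rho> \<le>
      \<open>r\<close> keeps it there.\<close>
    have close: "dist (x n) z + \<psi> n < \<rho>" if "N \<le> n" for n
      using that
    proof (induction rule: dec_induct)
      case base
      then show ?case using N by simp
    next
      case (step n)
      then have "dist (x n) z < r" using \<psi>_nonneg[of n] by (simp add: \<rho>_def)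
      from step'[OF this] show ?case
        using step.IH dist_triangle[of "x (Suc n)" z "x n"] by linarith
    qed
    have "dist (x n) z < \<rho>" if "N \<le> n" for n
      using close[OF that] \<psi>_nonneg[of n] by linarith
    then show "\<exists>N. \<forall>n\<ge>N. dist (x n) z < \<epsilon>"
      unfolding \<rho>_def min_less_iff_conj by blast
  qed
qed

text \<open>\<open>N\<close> is enumerated increasingly before compactness is applied, so that all
  indices of the subsequence stay in \<open>N\<close>.\<close>

lemma infinite_compact_convergent_subseq:
  fixes x :: "nat \<Rightarrow> 'a::metric_space"
  assumes "infinite N" "compact K" "\<And>n. n \<in> N \<Longrightarrow> x n \<in> K"
  obtains s z where "strict_mono s" "range s \<subseteq> N" "z \<in> K" "(x \<circ> s) \<longlonglongrightarrow> z"
proof -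
  let ?e = "enumerate N"
  have "\<forall>n. (x \<circ> ?e) n \<in> K"
    using assms enumerate_in_set by force
  then obtain z r where zr: "z \<in> K" "strict_mono r" "((x \<circ> ?e) \<circ> r) \<longlonglongrightarrow> z"
    using \<open>compact K\<close> unfolding compact_def by metis
  show thesis
  proof
    show "strict_mono (?e \<circ> r)"
      using zr(2) strict_mono_enumerate[OF \<open>infinite N\<close>] by (intro strict_mono_o)
    show "range (?e \<circ> r) \<subseteq> N"
      using assms(1) by (auto intro: enumerate_in_set)
    show "(x \<circ> (?e \<circ> r)) \<longlonglongrightarrow> z" using zr(3) by (simp add: o_assoc)
  qed (use zr in auto)
qed

lemma not_diverges_imp_cluster_point:
  fixes x :: "nat \<Rightarrow> 'a::euclidean_space"
  assumes "\<not> filterlim (\<lambda>n. norm (x n)) at_top sequentially"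
  obtains s z where "strict_mono s" "(x \<circ> s) \<longlonglongrightarrow> z"
proof -
  obtain R where "\<not> (\<forall>\<^sub>F n in sequentially. R \<le> norm (x n))"
    using assms unfolding filterlim_at_top by blast
  then have "infinite {n. \<not> R \<le> norm (x n)}"
    by (simp add: eventually_cofinite flip: cofinite_eq_sequentially)
  then show thesis
  proof (rule infinite_compact_convergent_subseq[where x = x])
    show "x n \<in> cball 0 R" if "n \<in> {n. \<not> R \<le> norm (x n)}" for n
      using that by simp
  qed (use that in auto)
qed

text \<open>If \<open>x\<close> stayed away from its cluster point \<open>z\<close> infinitely often, it would cross infinitely often
  some sphere around \<open>z\<close> that avoids the countable set of cluster points, and by the vanishing steps
  the crossings would accumulate on that sphere.\<close>

lemma countable_cluster_points_imp_limit:
  fixes x :: "nat \<Rightarrow> 'a::heine_borel"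
  assumes "countable C"
    and C: "\<And>s p. strict_mono s \<Longrightarrow> (x \<circ> s) \<longlonglongrightarrow> p \<Longrightarrow> p \<in> C"
    and step: "\<And>s p. strict_mono s \<Longrightarrow> (x \<circ> s) \<longlonglongrightarrow> p \<Longrightarrow>
      (\<lambda>n. dist (x (Suc (s n))) (x (s n))) \<longlonglongrightarrow> 0"
    and s: "strict_mono s" "(x \<circ> s) \<longlonglongrightarrow> z"
  shows "x \<longlonglongrightarrow> z"
proof (rule ccontr)
  assume "\<not> ?thesis"
  then obtain r0 where r0: "0 < r0" "\<And>N. \<exists>n\<ge>N. r0 \<le> dist (x n) z"
    unfolding lim_sequentially by (metis not_le)
  \<comment> \<open>An interval is uncountable, so some radius below \<open>r0\<close> is not the
    distance from \<open>z\<close> to any point of \<open>C\<close>.\<close>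
  have "\<not> {0<..<r0} \<subseteq> (\<lambda>p. dist p z) ` C"
  proof
    assume "{0<..<r0} \<subseteq> (\<lambda>p. dist p z) ` C"
    then have "countable {0<..<r0}"
      by (rule countable_subset) (use \<open>countable C\<close> in simp)
    then show False using uncountable_open_interval[of 0 r0] r0(1) by simp
  qed
  then obtain r where r: "0 < r" "r < r0" and rC: "\<And>p. p \<in> C \<Longrightarrow> dist p z \<noteq> r"
    unfolding subset_iff image_iff by auto
  define N where "N = {n. dist (x n) z < r \<and> r \<le> dist (x (Suc n)) z}"
  \<comment> \<open>After a late visit to the ball of radius \<open>r\<close> the sequence again
    reaches distance \<open>r0\<close>. Without an exit in between, induction would keep it inside
    the ball.\<close>
  have "\<exists>n\<ge>m. n \<in> N" for m
  proof -
    have "\<forall>\<^sub>F n in sequentially. m \<le> s n"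
      using filterlim_subseq[OF s(1)] by (simp only: filterlim_at_top)
    moreover have "\<forall>\<^sub>F n in sequentially. dist (x (s n)) z < r"
      using tendstoD[OF s(2) r(1)] by (simp only: o_def)
    ultimately have "\<forall>\<^sub>F n in sequentially. m \<le> s n \<and> dist (x (s n)) z < r"
      by (rule eventually_conj)
    then obtain i where i: "m \<le> i" "dist (x i) z < r"
      using eventually_happens[of _ sequentially] by auto
    obtain j where "i \<le> j" "r0 \<le> dist (x j) z"
      using r0(2)[of i] by blast
    then have j: "i \<le> j" "r \<le> dist (x j) z" using r by auto
    have "\<exists>n\<ge>i. n \<in> N"
    proof (rule ccontr)
      assume no: "\<not> (\<exists>n\<ge>i. n \<in> N)"
      have "dist (x j) z < r"
        using j(1)
      proof (induction rule: dec_induct)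
        case (step n)
        then have "n \<notin> N" using no by blast
        then show ?case using step.IH by (simp add: N_def)
      qed (rule i(2))
      then show False using j by simp
    qed
    then show ?thesis using i(1) order_trans by blast
  qed
  then have "infinite N"
    unfolding infinite_nat_iff_unbounded_le by blast
  moreover have "x n \<in> cball z r" if "n \<in> N" for n
    using that by (simp add: N_def dist_commute)
  ultimately obtain t p
    where t: "strict_mono t" "range t \<subseteq> N" "p \<in> cball z r" "(x \<circ> t) \<longlonglongrightarrow> p"
    using infinite_compact_convergent_subseq[of N "cball z r" x] compact_cball by metis
  have tN: "t n \<in> N" for n using t(2) by blast
  have d: "(\<lambda>n. dist (x (t n)) z) \<longlonglongrightarrow> dist p z"
    using t(4) by (intro tendsto_intros) (simp add: o_def)
  have "dist p z \<le> r"
    using tN by (intro LIMSEQ_le_const2[OF d]) (auto simp: N_def intro: less_imp_le)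
  \<comment> \<open>The point after an exit has distance at least \<open>r\<close>, and the length
    of the exiting step tends to 0. So \<open>p\<close> lies exactly on the sphere that was chosen
    to avoid \<open>C\<close>.\<close>
  moreover have "r \<le> dist p z"
  proof (rule LIMSEQ_le_const)
    show "(\<lambda>n. dist (x (Suc (t n))) (x (t n)) + dist (x (t n)) z) \<longlonglongrightarrow> dist p z"
      using tendsto_add[OF step[OF t(1,4)] d] by simp
    show "\<exists>M. \<forall>n\<ge>M. r \<le> dist (x (Suc (t n))) (x (t n)) + dist (x (t n)) z"
    proof (intro exI allI impI)
      fix n
      show "r \<le> dist (x (Suc (t n))) (x (t n)) + dist (x (t n)) z"
        using tN[of n] dist_triangle[of "x (Suc (t n))" z "x (t n)"] by (simp add: N_def)
    qed
  qed
  ultimately show False using rC[OF C[OF t(1,4)]] by simp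
qed

section \<open>The direction of a single step\<close>

lemma nqn_kappa_gap:
  assumes "i \<le> m" "j \<le> m" "i \<noteq> j"
  shows "2 * nqn_kappa m \<delta> \<le> \<bar>\<delta> i - \<delta> j\<bar>"
proof -
  let ?S = "{\<bar>\<delta> i - \<delta> j\<bar> | i j. i \<le> m \<and> j \<le> m \<and> i \<noteq> j}"
  have "?S \<subseteq> (\<lambda>(i, j). \<bar>\<delta> i - \<delta> j\<bar>) ` ({..m} \<times> {..m})" by auto
  then have "finite ?S" by (rule finite_subset) simp
  then have "Min ?S \<le> \<bar>\<delta> i - \<delta> j\<bar>" using assms by (intro Min_le) auto
  then show ?thesis by (simp add: nqn_kappa_def)
qed

text \<open>For positive \<open>m\<close> the pair (0, m) makes the set of differences nonempty, so
  \<open>Min\<close> is one of its elements, and injectivity makes all of them positive.\<close>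

lemma nqn_kappa_pos:
  assumes "inj_on \<delta> {0..m}" "0 < m"
  shows "0 < nqn_kappa m \<delta>"
proof -
  let ?S = "{\<bar>\<delta> i - \<delta> j\<bar> | i j. i \<le> m \<and> j \<le> m \<and> i \<noteq> j}"
  have "?S \<subseteq> (\<lambda>(i, j). \<bar>\<delta> i - \<delta> j\<bar>) ` ({..m} \<times> {..m})" by auto
  then have "finite ?S" by (rule finite_subset) simp
  moreover have "\<bar>\<delta> 0 - \<delta> m\<bar> \<in> ?S" using assms(2) by (intro CollectI exI conjI) auto
  then have "?S \<noteq> {}" by blast
  moreover have "0 < d" if "d \<in> ?S" for d
    using that assms(1) by (auto simp: inj_on_def)
  ultimately have "0 < Min ?S" by simp
  then show ?thesis by (simp add: nqn_kappa_def)
qed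

lemma nqn_shift_mult:
  "nqn_shift f \<delta> \<tau> x j *v v = hessian f x *v v + (\<delta> j * norm (gradient f x) powr \<tau>) *\<^sub>R v"
  by (simp add: nqn_shift_def matrix_vector_mult_add_rdistrib scaleR_matrix_vector_assoc[symmetric])

lemma le_minsp_iff:
  fixes A :: "real^'n^'n"
  shows "c \<le> minsp A \<longleftrightarrow> (\<forall>v. norm v = 1 \<longrightarrow> c \<le> norm (A *v v))"
proof -
  have "sphere (0::real^'n) 1 \<noteq> {}" by simp
  moreover have "bdd_below ((\<lambda>v. norm (A *v v)) ` sphere 0 1)"
    by (rule bdd_belowI[of _ 0]) auto
  ultimately show ?thesis
    unfolding minsp_def by (subst le_cINF_iff) auto
qed

text \<open>Existence of an acceptable index guarantees that the \<open>LEAST\<close> in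
  \<open>nqn_matrix\<close> satisfies its predicate. The shifts and the required gap carry the same
  factor \<open>norm (gradient f x) powr \<tau>\<close>, so the result on self-adjoint operators
  applies to the scaled shifts.\<close>

lemma nqn_matrix_is_good_shift:
  fixes f :: "real^'n \<Rightarrow> real"
  assumes "C2_function f"
  obtains j where "j \<le> CARD('n)" "nqn_matrix f \<delta> \<tau> x = nqn_shift f \<delta> \<tau> x j"
    "\<And>v. norm v = 1 \<Longrightarrow>
      nqn_kappa CARD('n) \<delta> * norm (gradient f x) powr \<tau> \<le> norm (nqn_matrix f \<delta> \<tau> x *v v)"
proof -
  let ?s = "norm (gradient f x) powr \<tau>"
  let ?P = "\<lambda>j. j \<le> CARD('n) \<and> minsp (nqn_shift f \<delta> \<tau> x j) \<ge> nqn_kappa CARD('n) \<delta> * ?s"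
  have "2 * (nqn_kappa CARD('n) \<delta> * ?s) \<le> \<bar>\<delta> i * ?s - \<delta> j * ?s\<bar>"
    if "i \<le> DIM(real^'n)" "j \<le> DIM(real^'n)" "i \<noteq> j" for i j
  proof -
    have "(2 * nqn_kappa CARD('n) \<delta>) * ?s \<le> \<bar>\<delta> i - \<delta> j\<bar> * ?s"
      using that by (intro mult_right_mono nqn_kappa_gap) auto
    then show ?thesis by (simp add: abs_mult flip: left_diff_distrib)
  qed
  with C2_function_hessian_symmetric[OF assms, of x]
  have "\<exists>j\<le>DIM(real^'n). \<forall>v. norm v = 1 \<longrightarrow>
      nqn_kappa CARD('n) \<delta> * ?s \<le> norm (hessian f x *v v + (\<delta> j * ?s) *\<^sub>R v)"
    by (intro selfadjoint_exists_good_shift[where T = "\<lambda>v. hessian f x *v v" and d = "\<lambda>j. \<delta> j * ?s"])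
      simp_all
  then have "\<exists>j. ?P j" by (simp add: le_minsp_iff nqn_shift_mult)
  then have "?P (Least ?P)" by (rule LeastI_ex)
  then show thesis
    by (intro that[of "Least ?P"]) (simp_all add: nqn_matrix_def le_minsp_iff)
qed

text \<open>An upper bound for the norms of A e over unit vectors e. Summing over all shifts makes
  it independent of the selected index, so that it is continuous although \<open>nqn_matrix\<close>
  may jump.\<close>

definition nqn_bound :: "(real^'n \<Rightarrow> real) \<Rightarrow> (nat \<Rightarrow> real) \<Rightarrow> real \<Rightarrow> real^'n \<Rightarrow> real" where
  "nqn_bound f \<delta> \<tau> x =
     norm (hessian f x) + (\<Sum>j\<le>CARD('n). \<bar>\<delta> j\<bar>) * norm (gradient f x) powr \<tau>"

lemma nqn_matrix_hessian_diff:
  fixes f :: "real^'n \<Rightarrow> real"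
  assumes "C2_function f" "norm v = 1"
  shows "norm (nqn_matrix f \<delta> \<tau> x *v v - hessian f x *v v)
    \<le> (\<Sum>j\<le>CARD('n). \<bar>\<delta> j\<bar>) * norm (gradient f x) powr \<tau>"
proof -
  obtain j where j: "j \<le> CARD('n)" "nqn_matrix f \<delta> \<tau> x = nqn_shift f \<delta> \<tau> x j"
    using nqn_matrix_is_good_shift[OF assms(1)] by metis
  have "\<bar>\<delta> j\<bar> \<le> (\<Sum>j\<le>CARD('n). \<bar>\<delta> j\<bar>)"
    using j(1) by (intro member_le_sum) auto
  then show ?thesis
    using assms(2) by (simp add: j(2) nqn_shift_mult abs_mult mult_right_mono)
qed

lemma nqn_matrix_norm_le:
  assumes "C2_function f" "norm v = 1"
  shows "norm (nqn_matrix f \<delta> \<tau> x *v v) \<le> nqn_bound f \<delta> \<tau> x"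
  using nqn_matrix_hessian_diff[OF assms, of \<delta> \<tau> x] norm_matrix_vector_mult_le[of "hessian f x" v]
    norm_triangle_sub[of "nqn_matrix f \<delta> \<tau> x *v v" "hessian f x *v v"] assms(2)
  by (simp add: nqn_bound_def)

text \<open>Positivity of \<tau> gives continuity of the power also at base 0, that is, at critical
  points.\<close>

lemma isCont_nqn_bound:
  assumes "C2_function f" "0 < \<tau>"
  shows "isCont (nqn_bound f \<delta> \<tau>) x"
proof -
  have "((\<lambda>y. norm (gradient f y) powr \<tau>) \<longlongrightarrow> norm (gradient f x) powr \<tau>) (at x)"
    using C2_function_isCont(2)[OF assms(1), of x] assms(2)
    by (intro tendsto_powr2 tendsto_norm tendsto_const) (auto simp: isCont_def)
  then have "isCont (\<lambda>y. norm (gradient f y) powr \<tau>) x" by (simp only: isCont_def)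
  then show ?thesis
    unfolding nqn_bound_def[abs_def]
    using C2_function_isCont(3)[OF assms(1), of x]
    by (intro continuous_add continuous_mult continuous_norm continuous_const)
qed

section \<open>Runs that never reach a critical point\<close>

locale nqn_run =
  fixes f :: "real^'n \<Rightarrow> real" and \<delta> :: "nat \<Rightarrow> real" and \<tau> \<gamma>\<^sub>0 :: real
    and e :: "nat \<Rightarrow> 'n \<Rightarrow> real^'n" and x :: "nat \<Rightarrow> real^'n"
  assumes C2: "C2_function f"
    and inj_\<delta>: "inj_on \<delta> {0..CARD('n)}"
    and \<tau>: "0 < \<tau>" "\<tau> \<le> 1"
    and \<gamma>\<^sub>0: "0 < \<gamma>\<^sub>0" "\<gamma>\<^sub>0 < 1"
    and run: "nqn_sequence f \<delta> \<tau> \<gamma>\<^sub>0 e x"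
    and noncritical: "\<And>k. gradient f (x k) \<noteq> 0"
begin

abbreviation "g k \<equiv> gradient f (x k)"
abbreviation "l k i \<equiv> norm (nqn_matrix f \<delta> \<tau> (x k) *v e k i)"
abbreviation "w k \<equiv> nqn_w f \<delta> \<tau> (e k) (x k)"
abbreviation "wh k \<equiv> nqn_w_hat f \<delta> \<tau> (e k) (x k)"
abbreviation "\<gamma> k \<equiv> armijo_step f \<gamma>\<^sub>0 (x k) (wh k)"

lemma kappa_pos: "0 < nqn_kappa CARD('n) \<delta>"
  using inj_\<delta> by (intro nqn_kappa_pos) auto

lemma orthonormal: "orthonormal_basis (e k)"
  using run noncritical[of k] by (simp add: nqn_sequence_def Let_def)

lemma x_Suc: "x (Suc k) = x k - \<gamma> k *\<^sub>R wh k"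
  using run[unfolded nqn_sequence_def Let_def, rule_format, of k] noncritical[of k] by simp

lemma powr_pos: "0 < norm (g k) powr \<tau>"
  using noncritical[of k] by simp

lemma l_lower: "nqn_kappa CARD('n) \<delta> * norm (g k) powr \<tau> \<le> l k i"
  using nqn_matrix_is_good_shift[OF C2, of \<delta> \<tau> "x k"] orthonormal_basis_norm[OF orthonormal]
  by metis

lemma l_lower_pos: "0 < nqn_kappa CARD('n) \<delta> * norm (g k) powr \<tau>"
  using kappa_pos powr_pos by simp

lemma l_pos: "0 < l k i"
  using l_lower[of k i] l_lower_pos[of k] by linarith

lemma l_upper: "l k i \<le> nqn_bound f \<delta> \<tau> (x k)"
  by (intro nqn_matrix_norm_le C2 orthonormal_basis_norm orthonormal)

lemma w_eq: "w k = (\<Sum>i\<in>UNIV. (g k \<bullet> e k i / l k i) *\<^sub>R e k i)"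
  by (simp add: nqn_w_def)

lemma norm_wh: "norm (wh k) = min 1 (norm (w k))"
proof (cases "1 \<le> norm (w k)")
  case True
  then have "w k \<noteq> 0" by auto
  then show ?thesis using True by (simp add: nqn_w_hat_def)
qed (simp add: nqn_w_hat_def)

lemma norm_wh_le: "norm (wh k) \<le> 1" "norm (wh k) \<le> norm (w k)"
  by (simp_all add: norm_wh)

text \<open>Passing from \<open>w k\<close> to \<open>wh k\<close> multiplies by a positive scalar
  and so keeps the cosine. The interval from \<open>lo\<close> to \<open>hi\<close> stays general:
  it is used with local bounds and with the extremes occurring in \<open>nqn_ratio\<close>.\<close>

lemma direction_bounds:
  assumes "0 < lo" "lo \<le> hi" "\<And>i. g k \<bullet> e k i \<noteq> 0 \<Longrightarrow> lo \<le> l k i \<and> l k i \<le> hi"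
  shows "norm (g k) \<le> hi * norm (w k)"
    and "sqrt (lo / hi) * (norm (wh k) * norm (g k)) \<le> wh k \<bullet> g k"
proof -
  note b = rescaled_vector_bounds[OF orthonormal assms w_eq]
  show "norm (g k) \<le> hi * norm (w k)" by (rule b(1))
  define c where "c = inverse (max 1 (norm (w k)))"
  have c: "0 \<le> c" "wh k = c *\<^sub>R w k"
    by (simp_all add: c_def nqn_w_hat_def)
  have "c * (sqrt (lo / hi) * (norm (w k) * norm (g k))) \<le> c * (w k \<bullet> g k)"
    using b(2) c(1) by (rule mult_left_mono)
  then show "sqrt (lo / hi) * (norm (wh k) * norm (g k)) \<le> wh k \<bullet> g k"
    using c(1) by (simp only: c(2) norm_scaleR abs_of_nonneg inner_scaleR_left mult_ac)
qed

text \<open>The lower end comes from the acceptance test for the shift, the upper end is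
  \<open>M\<close>. The cosine is thus at least of order \<open>norm (g k)\<close> to the power
  \<tau>/2.\<close>

lemma direction_bounds_local:
  assumes M: "nqn_bound f \<delta> \<tau> (x k) \<le> M"
  shows "nqn_kappa CARD('n) \<delta> * norm (g k) powr \<tau> \<le> M" "norm (g k) \<le> M * norm (w k)"
    and "sqrt (nqn_kappa CARD('n) \<delta> * norm (g k) powr \<tau> / M) * (norm (wh k) * norm (g k)) \<le> wh k \<bullet> g k"
proof -
  show *: "nqn_kappa CARD('n) \<delta> * norm (g k) powr \<tau> \<le> M"
    \<comment> \<open>\<open>undefined\<close> stands for an arbitrary index; any one shows that the
      lower end is at most \<open>M\<close>.\<close>
    using l_lower[of k undefined] l_upper[of k undefined] M by linarith
  have "nqn_kappa CARD('n) \<delta> * norm (g k) powr \<tau> \<le> l k i \<and> l k i \<le> M" for i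
    using l_lower[of k i] l_upper[of k i] M by linarith
  then show "norm (g k) \<le> M * norm (w k)"
    "sqrt (nqn_kappa CARD('n) \<delta> * norm (g k) powr \<tau> / M) * (norm (wh k) * norm (g k)) \<le> wh k \<bullet> g k"
    using direction_bounds[OF l_lower_pos *] by blast+
qed

lemma descent_direction: "0 < wh k \<bullet> g k"
proof -
  let ?M = "nqn_bound f \<delta> \<tau> (x k)"
  note b = direction_bounds_local[OF order_refl, of k]
  have M: "0 < ?M" using b(1) l_lower_pos[of k] by linarith
  have "w k \<noteq> 0" using b(2) noncritical[of k] by auto
  then have "0 < norm (wh k)" by (simp add: norm_wh)
  then have "0 < sqrt (nqn_kappa CARD('n) \<delta> * norm (g k) powr \<tau> / ?M) * (norm (wh k) * norm (g k))"
    using M l_lower_pos[of k] noncritical[of k] by simp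
  then show ?thesis using b(3) by linarith
qed

section \<open>Backtracking and decrease of the function along the run\<close>

lemma armijo_small:
  assumes "\<And>y. dist y (x k) \<le> \<eta> \<Longrightarrow> dist (gradient f y) (g k) \<le> 2/3 * (wh k \<bullet> g k)"
    and "0 < \<gamma>'" "\<gamma>' \<le> \<eta>"
  shows "armijo f (x k) (wh k) \<gamma>'"
  using assms by (intro armijo_small_step[of f "wh k" "x k" \<eta>] C2_function_GDERIV C2 norm_wh_le)

text \<open>Continuity of the gradient makes the backtracking search stop, so that the
  \<open>LEAST\<close> in \<open>armijo_step\<close> is attained.\<close>

lemma armijo_eventually:
  obtains \<eta> where "0 < \<eta>" "\<And>\<gamma>'. 0 < \<gamma>' \<Longrightarrow> \<gamma>' \<le> \<eta> \<Longrightarrow> armijo f (x k) (wh k) \<gamma>'"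
proof -
  have "0 < 2/3 * (wh k \<bullet> g k)" using descent_direction[of k] by simp
  then obtain d where d: "0 < d"
      "\<And>y. dist y (x k) < d \<Longrightarrow> dist (gradient f y) (g k) < 2/3 * (wh k \<bullet> g k)"
    using C2_function_isCont(2)[OF C2, of "x k"] unfolding continuous_at_eps_delta by metis
  have "armijo f (x k) (wh k) \<gamma>'" if "0 < \<gamma>'" "\<gamma>' \<le> d / 2" for \<gamma>'
  proof (rule armijo_small[OF _ that])
    fix y assume "dist y (x k) \<le> d / 2"
    then have "dist y (x k) < d" using d(1) by linarith
    then show "dist (gradient f y) (g k) \<le> 2/3 * (wh k \<bullet> g k)" using d(2) less_imp_le by blast
  qed
  then show thesis using that[of "d / 2"] d(1) by simp
qed

lemma step_size: "0 < \<gamma> k" "\<gamma> k < 1"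
proof -
  obtain \<eta> where \<eta>: "0 < \<eta>" "\<And>\<gamma>'. 0 < \<gamma>' \<Longrightarrow> \<gamma>' \<le> \<eta> \<Longrightarrow> armijo f (x k) (wh k) \<gamma>'"
    using armijo_eventually[of k] by blast
  note b = armijo_step_bounds[OF \<gamma>\<^sub>0(1) \<eta>]
  have "0 < min \<gamma>\<^sub>0 (\<eta> / 3)" using \<gamma>\<^sub>0 \<eta>(1) by simp
  then show "0 < \<gamma> k" "\<gamma> k < 1" using b(2,3) \<gamma>\<^sub>0(2) by linarith+
qed

lemma descent: "1/3 * \<gamma> k * (wh k \<bullet> g k) \<le> f (x k) - f (x (Suc k))"
proof -
  obtain \<eta> where \<eta>: "0 < \<eta>" "\<And>\<gamma>'. 0 < \<gamma>' \<Longrightarrow> \<gamma>' \<le> \<eta> \<Longrightarrow> armijo f (x k) (wh k) \<gamma>'"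
    using armijo_eventually[of k] by blast
  show ?thesis
    using armijo_step_bounds(1)[OF \<gamma>\<^sub>0(1) \<eta>] unfolding armijo_def x_Suc[of k] by linarith
qed

lemma strict_descent: "f (x (Suc k)) < f (x k)"
proof -
  have "0 < 1/3 * \<gamma> k * (wh k \<bullet> g k)" using step_size[of k] descent_direction[of k] by simp
  then show ?thesis using descent[of k] by linarith
qed

lemma dist_step: "dist (x (Suc k)) (x k) = \<gamma> k * norm (wh k)"
  using step_size[of k] by (simp add: x_Suc[of k] dist_norm)

lemma dist_step_le: "dist (x (Suc k)) (x k) \<le> norm (w k)"
proof -
  have "\<gamma> k * norm (wh k) \<le> 1 * norm (w k)"
    using step_size[of k] norm_wh_le[of k] by (intro mult_mono) auto
  then show ?thesis by (simp add: dist_step)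
qed

text \<open>Here \<open>c\<close> is a lower bound for the cosine of the angle between direction and
  gradient, and the factor 1/3 is Armijo's.\<close>

lemma descent_dist:
  assumes "c * (norm (wh k) * norm (g k)) \<le> wh k \<bullet> g k"
  shows "c / 3 * dist (x (Suc k)) (x k) * norm (g k) \<le> f (x k) - f (x (Suc k))"
proof -
  have "c / 3 * dist (x (Suc k)) (x k) * norm (g k)
      = 1/3 * \<gamma> k * (c * (norm (wh k) * norm (g k)))"
    by (simp add: dist_step)
  also have "\<dots> \<le> 1/3 * \<gamma> k * (wh k \<bullet> g k)"
    using assms step_size[of k] by (intro mult_left_mono) auto
  finally show ?thesis using descent[of k] by linarith
qed

section \<open>Behaviour near cluster points\<close>

lemma bound_near:
  obtains r M where "0 < r" "0 < M" "\<And>k. dist (x k) p < r \<Longrightarrow> nqn_bound f \<delta> \<tau> (x k) \<le> M"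
proof -
  obtain r where r: "0 < r"
      "\<And>y. dist y p < r \<Longrightarrow> dist (nqn_bound f \<delta> \<tau> y) (nqn_bound f \<delta> \<tau> p) < 1"
    using isCont_nqn_bound[OF C2 \<tau>(1), where \<delta> = \<delta> and x = p] unfolding continuous_at_eps_delta
    by (metis zero_less_one)
  show thesis
  proof
    show "nqn_bound f \<delta> \<tau> (x k) \<le> \<bar>nqn_bound f \<delta> \<tau> p\<bar> + 1" if "dist (x k) p < r" for k
      using r(2)[OF that] by (simp add: dist_real_def)
  qed (use r(1) in auto)
qed

text \<open>The values decrease, so convergence along a subsequence gives convergence of all.
  Comparing with the next iterate makes the inequality strict, which keeps the gap to
  \<open>f p\<close> positive in the Lojasiewicz argument.\<close>

lemma cluster_point_values:
  assumes "strict_mono s" "(x \<circ> s) \<longlonglongrightarrow> p"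
  shows "(\<lambda>k. f (x k)) \<longlonglongrightarrow> f p" "f p < f (x k)"
proof -
  have dec: "decseq (\<lambda>k. f (x k))"
    using strict_descent by (intro decseq_SucI less_imp_le)
  have sub: "(\<lambda>n. f (x (s n))) \<longlonglongrightarrow> f p"
    using isCont_tendsto_compose[OF C2_function_isCont(1)[OF C2] assms(2)] by (simp add: o_def)
  have ge: "f p \<le> f (x k)" for k
  proof (rule LIMSEQ_le_const2[OF sub], intro exI allI impI)
    fix n assume "k \<le> n"
    then have "k \<le> s n" using seq_suble[OF assms(1), of n] by linarith
    then show "f (x (s n)) \<le> f (x k)" using dec by (simp add: decseq_def)
  qed
  show "f p < f (x k)" using ge[of "Suc k"] strict_descent[of k] by linarith
  obtain L where L: "(\<lambda>k. f (x k)) \<longlonglongrightarrow> L"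
    using decseq_convergent[OF dec, of "f p"] ge by blast
  have "L = f p"
    using LIMSEQ_unique[OF _ sub] LIMSEQ_subseq_LIMSEQ[OF L assms(1)] by (simp add: o_def)
  then show "(\<lambda>k. f (x k)) \<longlonglongrightarrow> f p" using L by simp
qed

text \<open>Near a noncritical cluster point the direction is uniformly one of descent and the step
  size is bounded below. Each visit then costs a fixed amount \<open>D\<close>, which contradicts
  convergence of the values.\<close>

lemma cluster_point_critical:
  assumes s: "strict_mono s" "(x \<circ> s) \<longlonglongrightarrow> p"
  shows "gradient f p = 0"
proof (rule ccontr)
  assume "gradient f p \<noteq> 0"
  define G where "G = norm (gradient f p) / 2"
  have G: "0 < G" using \<open>gradient f p \<noteq> 0\<close> by (simp add: G_def)
  obtain r1 M where r1: "0 < r1" "0 < M"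
      "\<And>k. dist (x k) p < r1 \<Longrightarrow> nqn_bound f \<delta> \<tau> (x k) \<le> M"
    using bound_near by blast
  \<comment> \<open>A lower bound for \<open>wh k \<bullet> g k\<close> near \<open>p\<close>, from
    \<open>norm (g k)\<close> at least \<open>G\<close> and \<open>norm (wh k)\<close> at least
    \<open>min 1 (G / M)\<close>.\<close>
  define c where "c = sqrt (nqn_kappa CARD('n) \<delta> * G powr \<tau> / M) * (min 1 (G / M) * G)"
  have c: "0 < c" using G r1(2) kappa_pos by (simp add: c_def)
  \<comment> \<open>The tolerance \<open>G\<close>, half the gradient norm at \<open>p\<close>,
    keeps \<open>norm (g k)\<close> at least \<open>G\<close>. Two errors below \<open>c / 3\<close>
    add up to the 2/3 in \<open>armijo_small\<close>.\<close>
  then have "0 < min G (c / 3)" using G by simp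
  then obtain r2 where r2: "0 < r2"
      "\<And>y. dist y p < r2 \<Longrightarrow> dist (gradient f y) (gradient f p) < min G (c / 3)"
    using C2_function_isCont(2)[OF C2, of p] unfolding continuous_at_eps_delta by metis
  \<comment> \<open>Points within r2/4 of an iterate that is within r2/2 of \<open>p\<close> stay
    within \<open>r2\<close> of \<open>p\<close>.\<close>
  define \<eta> where "\<eta> = r2 / 4"
  have \<eta>: "0 < \<eta>" using r2 by (simp add: \<eta>_def)
  \<comment> \<open>Armijo's constant times the lower bound for the step size times the lower bound
    for the slope.\<close>
  define D where "D = 1/3 * min \<gamma>\<^sub>0 (\<eta> / 3) * c"
  have D: "0 < D" using \<gamma>\<^sub>0 \<eta> c by (simp add: D_def)
  have drop: "D \<le> f (x k) - f (x (Suc k))" if k: "dist (x k) p < min r1 (r2 / 2)" for k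
  proof -
    have "dist (g k) (gradient f p) < G" using r2(2)[of "x k"] k r2(1) by simp
    then have gk: "G \<le> norm (g k)"
      using norm_triangle_ineq3[of "g k" "gradient f p"] by (simp add: dist_norm G_def)
    have "nqn_bound f \<delta> \<tau> (x k) \<le> M" using r1(3) k by simp
    note b = direction_bounds_local[OF this]
    have "G / M \<le> norm (w k)"
      using b(2) gk r1(2) by (simp add: divide_le_eq mult.commute)
    then have "min 1 (G / M) \<le> norm (wh k)" by (simp add: norm_wh)
    moreover have "nqn_kappa CARD('n) \<delta> * G powr \<tau> / M \<le> nqn_kappa CARD('n) \<delta> * norm (g k) powr \<tau> / M"
      using gk G \<tau> kappa_pos r1(2) by (intro divide_right_mono mult_left_mono powr_mono2) auto
    ultimately have "c \<le> sqrt (nqn_kappa CARD('n) \<delta> * norm (g k) powr \<tau> / M) * (norm (wh k) * norm (g k))"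
      unfolding c_def using gk G r1(2) kappa_pos
      by (intro mult_mono) auto
    then have cw: "c \<le> wh k \<bullet> g k" using b(3) by linarith
    have "armijo f (x k) (wh k) \<gamma>'" if "0 < \<gamma>'" "\<gamma>' \<le> \<eta>" for \<gamma>'
    proof (rule armijo_small[OF _ that])
      fix y assume "dist y (x k) \<le> \<eta>"
      then have "dist y p < r2"
        using dist_triangle[of y p "x k"] k r2(1) by (simp add: \<eta>_def)
      then have "dist (gradient f y) (gradient f p) < c / 3" using r2(2) by simp
      moreover have "dist (g k) (gradient f p) < c / 3" using r2(2)[of "x k"] k r2(1) by simp
      ultimately have "dist (gradient f y) (g k) \<le> 2/3 * c"
        using dist_triangle2[of "gradient f y" "g k" "gradient f p"] by linarith
      then show "dist (gradient f y) (g k) \<le> 2/3 * (wh k \<bullet> g k)" using cw by linarith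
    qed
    from armijo_step_bounds(2)[OF \<gamma>\<^sub>0(1) \<eta> this]
    have "D \<le> 1/3 * \<gamma> k * (wh k \<bullet> g k)"
      unfolding D_def using cw c \<gamma>\<^sub>0 \<eta> step_size[of k] by (intro mult_mono) auto
    then show ?thesis using descent[of k] by linarith
  qed
  note lim = cluster_point_values(1)[OF s]
  have "(\<lambda>k. f (x k) - f (x (Suc k))) \<longlonglongrightarrow> 0"
    using tendsto_diff[OF lim LIMSEQ_Suc[OF lim]] by simp
  then have "(\<lambda>n. f (x (s n)) - f (x (Suc (s n)))) \<longlonglongrightarrow> 0"
    using LIMSEQ_subseq_LIMSEQ[OF _ s(1)] by (force simp: o_def)
  then have "\<forall>\<^sub>F n in sequentially. f (x (s n)) - f (x (Suc (s n))) < D"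
    using D by (rule order_tendstoD)
  moreover have "0 < min r1 (r2 / 2)" using r1(1) r2(1) by simp
  then have "\<forall>\<^sub>F n in sequentially. dist (x (s n)) p < min r1 (r2 / 2)"
    using tendstoD[OF s(2)] by (simp only: o_def)
  ultimately have "\<forall>\<^sub>F n in sequentially. False"
    by eventually_elim (use drop in force)
  then show False by simp
qed

text \<open>Raising Lojasiewicz's inequality to the power \<alpha> bounds the gap to
  \<open>f p\<close>, to the power \<open>\<mu> * \<alpha>\<close>, by a multiple of the gradient
  norm to the power \<alpha>. Hence \<open>cluster_point_imp_limit\<close> applies with \<theta> =
  \<open>\<mu> * \<alpha>\<close>. Part 2 takes \<alpha> = 1 + \<tau>/2, part 3 takes \<alpha> =
  1.\<close>

lemma lojasiewicz_imp_limit: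
  assumes s: "strict_mono s" "(x \<circ> s) \<longlonglongrightarrow> p"
    and loj: "lojasiewicz_ineq f p \<mu>" and \<mu>: "0 < \<mu>" "0 < \<alpha>" "\<mu> * \<alpha> < 1"
    and "0 < r" "0 < c"
    and step: "\<And>k. dist (x k) p < r \<Longrightarrow>
      c * dist (x (Suc k)) (x k) * norm (g k) powr \<alpha> \<le> f (x k) - f (x (Suc k))"
  shows "x \<longlonglongrightarrow> p"
proof -
  obtain U C where U: "open U" "p \<in> U" "0 < C"
      "\<And>y z. y \<in> U \<Longrightarrow> z \<in> U \<Longrightarrow> \<bar>f y - f z\<bar> powr \<mu> \<le> C * norm (gradient f y)"
    using loj unfolding lojasiewicz_ineq_def by blast
  obtain r' where r': "0 < r'" "ball p r' \<subseteq> U"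
    using U(1,2) open_contains_ball by blast
  define \<phi> where "\<phi> k = f (x k) - f p" for k
  have pos: "0 < \<phi> k" for k using cluster_point_values(2)[OF s] by (simp add: \<phi>_def)
  show ?thesis
  proof (rule cluster_point_imp_limit[where \<phi> = \<phi> and \<theta> = "\<mu> * \<alpha>" and r = "min r r'"
        and K = "C powr \<alpha> / c", OF pos _ _ \<mu>(3) _ _ _ s])
    show "\<phi> \<longlonglongrightarrow> 0"
      unfolding \<phi>_def[abs_def] using tendsto_diff[OF cluster_point_values(1)[OF s] tendsto_const[of "f p"]] by simp
    fix k assume k: "dist (x k) p < min r r'"
    then have "x k \<in> U" using r'(2) by (auto simp: dist_commute)
    then have "\<phi> k powr \<mu> \<le> C * norm (g k)"
      using U(4)[of "x k" p] U(2) pos[of k] by (simp add: \<phi>_def)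
    then have "(\<phi> k powr \<mu>) powr \<alpha> \<le> (C * norm (g k)) powr \<alpha>"
      using \<mu> by (intro powr_mono2) auto
    then have "\<phi> k powr (\<mu> * \<alpha>) \<le> C powr \<alpha> * norm (g k) powr \<alpha>"
      using U(3) by (simp add: powr_powr powr_mult)
    then have "dist (x (Suc k)) (x k) * \<phi> k powr (\<mu> * \<alpha>)
        \<le> dist (x (Suc k)) (x k) * (C powr \<alpha> * norm (g k) powr \<alpha>)"
      by (intro mult_left_mono) auto
    also have "\<dots> = C powr \<alpha> / c * (c * dist (x (Suc k)) (x k) * norm (g k) powr \<alpha>)"
      using \<open>0 < c\<close> by simp
    also have "\<dots> \<le> C powr \<alpha> / c * (\<phi> k - \<phi> (Suc k))"
      using step[of k] k \<open>0 < c\<close> by (intro mult_left_mono) (auto simp: \<phi>_def)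
    finally show "dist (x (Suc k)) (x k) * \<phi> k powr (\<mu> * \<alpha>) \<le> C powr \<alpha> / c * (\<phi> k - \<phi> (Suc k))" .
  qed (use \<open>0 < r\<close> r'(1) \<open>0 < c\<close> \<mu> in auto)
qed

text \<open>Each coefficient of \<open>w\<close> has its denominator bounded below by a multiple of
  the power \<mu> of its numerator. The coefficient is thus at most a multiple of the power 1 -
  \<mu> of the numerator, and this tends to 0 with the gradient.\<close>

lemma w_tendsto_0:
  assumes s: "strict_mono s" "(x \<circ> s) \<longlonglongrightarrow> p"
    and crit: "gradient f p = 0" and loj: "gradient_lojasiewicz_at f p"
  shows "(\<lambda>n. norm (w (s n))) \<longlonglongrightarrow> 0"
proof -
  let ?F = "\<lambda>q. gradient f (fst q) \<bullet> snd q"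
  \<comment> \<open>Symmetry of the Hessian moves it from the increment of y onto v.\<close>
  have grad_F: "gradient ?F (y, v) = (hessian f y *v v, gradient f y)" for y v :: "real^'n"
  proof (rule gradient_eqI)
    have "((\<lambda>q. gradient f (fst q)) has_derivative (\<lambda>h. hessian f y *v fst h)) (at (y, v))"
      by (rule has_derivative_compose[where g = "gradient f" and f = fst,
            OF has_derivative_fst[OF has_derivative_ident]])
        (simp add: C2_function_gradient_has_derivative[OF C2])
    from has_derivative_inner[OF this has_derivative_snd[OF has_derivative_ident]]
    have "(?F has_derivative (\<lambda>h. gradient f y \<bullet> snd h + (hessian f y *v fst h) \<bullet> v)) (at (y, v))"
      by simp
    moreover have "gradient f y \<bullet> snd h + (hessian f y *v fst h) \<bullet> v
        = h \<bullet> (hessian f y *v v, gradient f y)" for h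
      using C2_function_hessian_symmetric[OF C2, of y "fst h" v]
      by (simp add: inner_prod_def inner_commute[of "gradient f y"])
    ultimately show "GDERIV ?F (y, v) :> (hessian f y *v v, gradient f y)"
      unfolding gderiv_def by (simp only:)
  qed
  obtain \<mu> where \<mu>: "0 < \<mu>" "\<mu> < 1" and "lojasiewicz_ineq ?F (p, 0) \<mu>"
    using loj unfolding gradient_lojasiewicz_at_def lojasiewicz_at_def by blast
  then obtain U C where U: "open U" "(p, 0) \<in> U" "0 < C"
      "\<And>y z. y \<in> U \<Longrightarrow> z \<in> U \<Longrightarrow> \<bar>?F y - ?F z\<bar> powr \<mu> \<le> C * norm (gradient ?F y)"
    unfolding lojasiewicz_ineq_def by blast
  obtain V W where "open V" "open W" "(p, 0) \<in> V \<times> W" "V \<times> W \<subseteq> U"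
    by (rule open_prod_elim[OF U(1,2)])
  then have VW: "open V" "open W" "p \<in> V" "0 \<in> W" "V \<times> W \<subseteq> U" by simp_all
  obtain r where r: "0 < r" "ball 0 r \<subseteq> W"
    using openE[OF VW(2,4)] by blast
  \<comment> \<open>\<rho> < r puts the scaled basis vectors into \<open>W\<close>, and \<rho> \<le>
    1 lets the factor in front of the Hessian term be dropped.\<close>
  define \<rho> where "\<rho> = min 1 (r / 2)"
  have \<rho>: "0 < \<rho>" "\<rho> \<le> 1" "\<rho> < r" using r(1) by (auto simp: \<rho>_def)
  define \<Delta> where "\<Delta> = (\<Sum>j\<le>CARD('n). \<bar>\<delta> j\<bar>)"
  \<comment> \<open>Both \<Delta> times the power \<tau> of the gradient norm and the gradient norm
    itself are absorbed into \<open>l k i\<close> at the price of a division by \<kappa>.\<close>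
  define K where "K = C * (1 + (\<Delta> + 1) / nqn_kappa CARD('n) \<delta>)"
  have \<Delta>: "0 \<le> \<Delta>" by (simp add: \<Delta>_def sum_nonneg)
  then have K: "0 \<le> K" using U(3) kappa_pos by (simp add: K_def)
  \<comment> \<open>The inequality for the map \<open>?F\<close> at \<open>\<rho> e\<^sub>i\<close> bounds \<open>\<bar>\<langle>g, e\<^sub>i\<rangle>\<bar>\<^sup>\<mu>\<close> by a multiple of \<open>\<parallel>A e\<^sub>i\<parallel>\<close>.\<close>
  have coord: "\<bar>g k \<bullet> e k i / l k i\<bar> \<le> K / \<rho> powr \<mu> * norm (g k) powr (1 - \<mu>)"
    if k: "x k \<in> V" "norm (g k) < 1" for k i
  proof (cases "g k \<bullet> e k i = 0")
    case True
    then show ?thesis using K by simp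
  next
    case False
    let ?a = "\<bar>g k \<bullet> e k i\<bar>" and ?s = "norm (g k) powr \<tau>"
    have e1: "norm (e k i) = 1" by (intro orthonormal_basis_norm orthonormal)
    then have "\<rho> *\<^sub>R e k i \<in> ball 0 r" using \<rho> by simp
    then have "(x k, \<rho> *\<^sub>R e k i) \<in> U" using VW(5) k(1) r(2) by blast
    from U(4)[OF this U(2)]
    have "(\<rho> * ?a) powr \<mu> \<le> C * norm (\<rho> *\<^sub>R (hessian f (x k) *v e k i), g k)"
      using \<rho> by (simp add: grad_F abs_mult matrix_vector_mult_scaleR)
    also have "\<dots> \<le> C * (norm (hessian f (x k) *v e k i) + norm (g k))"
    proof -
      have "norm (\<rho> *\<^sub>R (hessian f (x k) *v e k i), g k)
          \<le> norm (\<rho> *\<^sub>R (hessian f (x k) *v e k i)) + norm (g k)"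
        by (rule norm_Pair_le)
      also have "norm (\<rho> *\<^sub>R (hessian f (x k) *v e k i)) \<le> norm (hessian f (x k) *v e k i)"
        using \<rho> by (simp add: mult_left_le_one_le)
      finally show ?thesis using U(3) by (intro mult_left_mono) auto
    qed
    also have "\<dots> \<le> K * l k i"
    proof -
      have "norm (hessian f (x k) *v e k i) \<le> l k i + \<Delta> * ?s"
        using nqn_matrix_hessian_diff[OF C2 e1, of \<delta> \<tau> "x k"]
          norm_triangle_sub[of "hessian f (x k) *v e k i" "nqn_matrix f \<delta> \<tau> (x k) *v e k i"]
        unfolding \<Delta>_def by (simp add: norm_minus_commute)
      \<comment> \<open>Since \<tau> \<le> 1 and the gradient norm is below 1, the shift term
        dominates the second component of the gradient of \<open>?F\<close>.\<close>
      moreover have "norm (g k) \<le> ?s"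
        using powr_mono'[of \<tau> 1 "norm (g k)"] \<tau>(2) k(2) by simp
      moreover have "?s \<le> l k i / nqn_kappa CARD('n) \<delta>"
        using l_lower[of k i] kappa_pos by (simp add: pos_le_divide_eq mult.commute)
      then have "(\<Delta> + 1) * ?s \<le> (\<Delta> + 1) * (l k i / nqn_kappa CARD('n) \<delta>)"
        using \<Delta> by (intro mult_left_mono) auto
      moreover have "(\<Delta> + 1) * ?s = \<Delta> * ?s + ?s" by (simp add: distrib_right)
      ultimately have "norm (hessian f (x k) *v e k i) + norm (g k)
          \<le> l k i + (\<Delta> + 1) * (l k i / nqn_kappa CARD('n) \<delta>)"
        by linarith
      also have "\<dots> = (1 + (\<Delta> + 1) / nqn_kappa CARD('n) \<delta>) * l k i"
        by (simp add: distrib_right)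
      finally show ?thesis using U(3) by (simp add: K_def mult.assoc mult_left_mono)
    qed
    finally have "\<rho> powr \<mu> * ?a powr \<mu> \<le> K * l k i"
      using \<rho> by (simp add: powr_mult)
    then have "?a powr \<mu> / l k i \<le> K / \<rho> powr \<mu>"
      using l_pos[of k i] \<rho>(1) by (simp add: pos_divide_le_eq pos_le_divide_eq mult.commute)
    then have "?a powr \<mu> / l k i * ?a powr (1 - \<mu>) \<le> K / \<rho> powr \<mu> * ?a powr (1 - \<mu>)"
      by (rule mult_right_mono) simp
    also have "?a powr (1 - \<mu>) \<le> norm (g k) powr (1 - \<mu>)"
      using Cauchy_Schwarz_ineq2[of "g k" "e k i"] e1 \<mu> by (intro powr_mono2) auto
    then have "K / \<rho> powr \<mu> * ?a powr (1 - \<mu>) \<le> K / \<rho> powr \<mu> * norm (g k) powr (1 - \<mu>)"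
      using K by (intro mult_left_mono) auto
    finally have *: "?a powr \<mu> / l k i * ?a powr (1 - \<mu>) \<le> K / \<rho> powr \<mu> * norm (g k) powr (1 - \<mu>)" .
    have "?a powr \<mu> * ?a powr (1 - \<mu>) = ?a"
      using False by (simp flip: powr_add)
    then have "?a powr \<mu> / l k i * ?a powr (1 - \<mu>) = \<bar>g k \<bullet> e k i / l k i\<bar>"
      by (simp only: times_divide_eq_left abs_divide abs_norm_cancel)
    then show ?thesis using * by (simp only:)
  qed
  define B where "B y = real CARD('n) * (K / \<rho> powr \<mu> * norm (gradient f y) powr (1 - \<mu>))" for y
  have w_le: "norm (w k) \<le> B (x k)" if "x k \<in> V" "norm (g k) < 1" for k
  proof -
    have "norm (w k) \<le> (\<Sum>i\<in>UNIV. norm ((g k \<bullet> e k i / l k i) *\<^sub>R e k i))"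
      unfolding w_eq by (rule norm_sum)
    also have "\<dots> = (\<Sum>i\<in>UNIV. \<bar>g k \<bullet> e k i / l k i\<bar>)"
      by (simp add: orthonormal_basis_norm[OF orthonormal])
    also have "\<dots> \<le> (\<Sum>i\<in>(UNIV::'n set). K / \<rho> powr \<mu> * norm (g k) powr (1 - \<mu>))"
      by (intro sum_mono coord that)
    finally show ?thesis by (simp add: B_def)
  qed
  have g_lim: "(\<lambda>n. norm (g (s n))) \<longlonglongrightarrow> 0"
    using isCont_tendsto_compose[OF C2_function_isCont(2)[OF C2] s(2)] crit
    by (intro tendsto_norm_zero) (simp add: o_def)
  have "(\<lambda>n. norm (g (s n)) powr (1 - \<mu>)) \<longlonglongrightarrow> 0"
    using \<mu> by (intro tendsto_zero_powrI[OF g_lim tendsto_const]) auto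
  then have B_lim: "(\<lambda>n. B (x (s n))) \<longlonglongrightarrow> 0"
    unfolding B_def by (intro tendsto_mult_right_zero)
  have "\<forall>\<^sub>F n in sequentially. x (s n) \<in> V"
    using topological_tendstoD[OF s(2) VW(1,3)] by simp
  moreover have "\<forall>\<^sub>F n in sequentially. norm (g (s n)) < 1"
    using g_lim by (rule order_tendstoD) simp
  ultimately have "\<forall>\<^sub>F n in sequentially. norm (w (s n)) \<le> B (x (s n))"
    by eventually_elim (rule w_le)
  then show ?thesis
    by (intro tendsto_sandwich[OF _ _ tendsto_const B_lim]) auto
qed

text \<open>Cluster points are critical, hence form a countable set, and step lengths are at most
  \<open>norm (w k)\<close>, which vanishes along convergent subsequences.\<close>

lemma limit_of_gradient_lojasiewicz:
  assumes s: "strict_mono s" "(x \<circ> s) \<longlonglongrightarrow> p"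
    and "countable {z. critical_point f z}" "gradient_lojasiewicz f"
  shows "x \<longlonglongrightarrow> p"
proof (rule countable_cluster_points_imp_limit[OF assms(3) _ _ s])
  fix t q assume t: "strict_mono t" "(x \<circ> t) \<longlonglongrightarrow> q"
  note crit = cluster_point_critical[OF t]
  then show "q \<in> {z. critical_point f z}" by (simp add: critical_point_def)
  have lim: "(\<lambda>n. norm (w (t n))) \<longlonglongrightarrow> 0"
    using assms(4) crit by (intro w_tendsto_0[OF t]) (auto simp: gradient_lojasiewicz_def critical_point_def)
  show "(\<lambda>n. dist (x (Suc (t n))) (x (t n))) \<longlonglongrightarrow> 0"
    by (rule tendsto_sandwich[OF _ _ tendsto_const lim]) (simp_all add: dist_step_le)
qed

text \<open>The cosine bound contributes \<tau>/2 to the power of the gradient norm in the decrease,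
  so convergence follows from \<mu> (1 + \<tau>/2) < 1 for an admissible \<mu> chosen close enough
  to the infimum.\<close>

lemma limit_of_small_exponent:
  assumes s: "strict_mono s" "(x \<circ> s) \<longlonglongrightarrow> p"
    and loj: "lojasiewicz_at f p" and exponent: "lojasiewicz_exponent f p * (1 + \<tau>) < 1"
  shows "x \<longlonglongrightarrow> p"
proof -
  have "lojasiewicz_exponent f p < 1 / (1 + \<tau>)"
    using exponent \<tau> by (simp add: pos_less_divide_eq)
  then have less: "Inf {\<mu>. 0 < \<mu> \<and> lojasiewicz_ineq f p \<mu>} < 1 / (1 + \<tau>)"
    by (simp only: lojasiewicz_exponent_def)
  \<comment> \<open>Nonemptiness is what lets an infimum below 1 / (1 + \<tau>) produce an actual
    exponent below it.\<close>
  have "{\<mu>. 0 < \<mu> \<and> lojasiewicz_ineq f p \<mu>} \<noteq> {}"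
    using loj unfolding lojasiewicz_at_def by blast
  from cInf_lessD[OF this less]
  obtain \<mu> where \<mu>: "0 < \<mu>" "lojasiewicz_ineq f p \<mu>" "\<mu> < 1 / (1 + \<tau>)"
    by blast
  have "\<mu> * (1 + \<tau>) < 1" using \<mu>(3) \<tau> by (simp add: pos_less_divide_eq)
  moreover have "\<mu> * (1 + \<tau> / 2) \<le> \<mu> * (1 + \<tau>)"
    using \<mu>(1) \<tau> by (intro mult_left_mono) auto
  ultimately have \<mu>\<tau>: "\<mu> * (1 + \<tau> / 2) < 1" by linarith
  obtain r M where rM: "0 < r" "0 < M"
      "\<And>k. dist (x k) p < r \<Longrightarrow> nqn_bound f \<delta> \<tau> (x k) \<le> M"
    using bound_near by blast
  define c where "c = sqrt (nqn_kappa CARD('n) \<delta> / M)"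
  show ?thesis
  proof (rule lojasiewicz_imp_limit[OF s \<mu>(2,1) _ \<mu>\<tau> rM(1), of "c / 3"])
    show "0 < c / 3" using kappa_pos rM(2) by (simp add: c_def)
    fix k assume k: "dist (x k) p < r"
    have *: "sqrt (nqn_kappa CARD('n) \<delta> * norm (g k) powr \<tau> / M) = c * norm (g k) powr (\<tau> / 2)"
    proof -
      have "sqrt (norm (g k) powr \<tau>) = norm (g k) powr (\<tau> / 2)"
        by (simp add: powr_half_sqrt[symmetric] powr_powr)
      moreover have "nqn_kappa CARD('n) \<delta> * norm (g k) powr \<tau> / M
          = nqn_kappa CARD('n) \<delta> / M * norm (g k) powr \<tau>" by simp
      ultimately show ?thesis unfolding c_def by (simp only: real_sqrt_mult)
    qed
    have "norm (g k) powr (1 + \<tau> / 2) = norm (g k) powr (\<tau> / 2) * norm (g k)"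
      by (simp add: powr_add)
    then have step: "c / 3 * dist (x (Suc k)) (x k) * norm (g k) powr (1 + \<tau> / 2)
        = sqrt (nqn_kappa CARD('n) \<delta> * norm (g k) powr \<tau> / M) / 3 * dist (x (Suc k)) (x k) * norm (g k)"
      unfolding * by simp
    show "c / 3 * dist (x (Suc k)) (x k) * norm (g k) powr (1 + \<tau> / 2) \<le> f (x k) - f (x (Suc k))"
      unfolding step
      by (rule descent_dist[OF direction_bounds_local(3)[OF rM(3)[OF k]]])
  qed (use \<tau> in simp)
qed

text \<open>The minimum and maximum over the indices with nonzero coordinate serve as
  \<open>lo\<close> and \<open>hi\<close>; this index set is nonempty because the gradient does not
  vanish.\<close>

lemma ratio_bounds:
  "0 < nqn_ratio f \<delta> \<tau> (e k) (x k)"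
  "sqrt (nqn_ratio f \<delta> \<tau> (e k) (x k)) * (norm (wh k) * norm (g k)) \<le> wh k \<bullet> g k"
proof -
  define \<Lambda> where "\<Lambda> = {i. g k \<bullet> e k i \<noteq> 0}"
  have "\<Lambda> \<noteq> {}"
  proof
    assume "\<Lambda> = {}"
    then have "(\<Sum>i\<in>UNIV. (g k \<bullet> e k i) *\<^sub>R e k i) = 0" by (auto simp: \<Lambda>_def)
    then have "g k = 0" using orthonormal_basis_expansion[OF orthonormal] by metis
    then show False using noncritical by blast
  qed
  then have fin: "finite (l k ` \<Lambda>)" "l k ` \<Lambda> \<noteq> {}" by auto
  have lo: "0 < Min (l k ` \<Lambda>)" using fin l_pos by (simp del: zero_less_norm_iff)
  have hi: "Min (l k ` \<Lambda>) \<le> Max (l k ` \<Lambda>)" using fin by (intro Min_le_iff[THEN iffD2]) auto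
  have ratio: "nqn_ratio f \<delta> \<tau> (e k) (x k) = Min (l k ` \<Lambda>) / Max (l k ` \<Lambda>)"
    by (simp add: nqn_ratio_def \<Lambda>_def Let_def)
  show "0 < nqn_ratio f \<delta> \<tau> (e k) (x k)"
    unfolding ratio using lo hi by (intro divide_pos_pos) linarith+
  show "sqrt (nqn_ratio f \<delta> \<tau> (e k) (x k)) * (norm (wh k) * norm (g k)) \<le> wh k \<bullet> g k"
    unfolding ratio using fin by (intro direction_bounds(2)[OF lo hi]) (auto simp: \<Lambda>_def)
qed

text \<open>Otherwise the ratios tend to 0 along some subsequence in a ball, and by compactness
  along a convergent one, whose limit inferior would be 0.\<close>

lemma ratio_lower_bound:
  assumes liminf: "\<And>r. strict_mono r \<Longrightarrow> convergent (x \<circ> r) \<Longrightarrow>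
      0 < liminf (\<lambda>n. ereal (nqn_ratio f \<delta> \<tau> (e (r n)) (x (r n))))"
  obtains c where "0 < c" "\<And>k. dist (x k) p < 1 \<Longrightarrow> c \<le> nqn_ratio f \<delta> \<tau> (e k) (x k)"
proof (rule ccontr)
  let ?R = "\<lambda>k. nqn_ratio f \<delta> \<tau> (e k) (x k)"
  assume "\<not> thesis"
  with that have small: "\<exists>k. dist (x k) p < 1 \<and> ?R k < c" if "0 < c" for c
    using \<open>0 < c\<close> by (metis not_le)
  let ?P = "\<lambda>n k. dist (x k) p < 1 \<and> ?R k < inverse (real (Suc n))"
  have "\<exists>k>m. ?P n k" for m n
  proof -
    \<comment> \<open>Including the positive ratios up to index \<open>m\<close> in the minimum
      forces the next index beyond \<open>m\<close>, which makes the chosen indices strictly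
      increasing.\<close>
    define c where "c = Min (insert (inverse (real (Suc n))) (?R ` {..m}))"
    have "0 < c" using ratio_bounds(1) by (simp add: c_def)
    then obtain k where k: "dist (x k) p < 1" "?R k < c" using small by blast
    then have "?R k < inverse (real (Suc n))" "\<forall>j\<le>m. ?R k < ?R j" by (simp_all add: c_def)
    then show ?thesis using k(1) by (metis less_irrefl not_le)
  qed
  then obtain t where t: "\<And>n. ?P n (t n)" "\<And>n. t n < t (Suc n)"
    using dependent_nat_choice[of ?P "\<lambda>n k k'. k < k'"] by metis
  have t_mono: "strict_mono t" using t(2) by (simp add: strict_mono_Suc_iff)
  have "x (t n) \<in> cball p 1" for n using t(1)[of n] by (simp add: dist_commute)
  then obtain q u where u: "strict_mono u" "((x \<circ> t) \<circ> u) \<longlonglongrightarrow> q"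
    using compact_cball[of p 1] unfolding compact_def by (metis comp_apply)
  have "convergent (x \<circ> (t \<circ> u))"
    using u(2) by (auto simp: convergent_def o_assoc)
  from liminf[OF strict_mono_o[OF t_mono u(1)] this]
  have pos: "0 < liminf (\<lambda>n. ereal (?R ((t \<circ> u) n)))" .
  have "(\<lambda>n. ?R (t n)) \<longlonglongrightarrow> 0"
  proof (rule tendsto_sandwich[OF _ _ tendsto_const LIMSEQ_inverse_real_of_nat])
    show "\<forall>\<^sub>F n in sequentially. ?R (t n) \<le> inverse (real (Suc n))"
      using t(1) by (intro always_eventually) (auto intro: less_imp_le)
    show "\<forall>\<^sub>F n in sequentially. 0 \<le> ?R (t n)"
      using ratio_bounds(1) by (intro always_eventually) (auto intro: less_imp_le)
  qed
  from LIMSEQ_subseq_LIMSEQ[OF this u(1)]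
  have "(\<lambda>n. ereal (?R ((t \<circ> u) n))) \<longlonglongrightarrow> ereal 0"
    by (simp add: o_def)
  then have "liminf (\<lambda>n. ereal (?R ((t \<circ> u) n))) = ereal 0"
    by (intro lim_imp_Liminf) auto
  then show False using pos by simp
qed

text \<open>With the cosine bounded below near \<open>p\<close>, the decrease is at least a multiple
  of step length times gradient norm, and any Lojasiewicz exponent below 1 suffices.\<close>

lemma limit_of_bounded_ratio:
  assumes s: "strict_mono s" "(x \<circ> s) \<longlonglongrightarrow> p"
    and loj: "lojasiewicz_at f p"
    and liminf: "\<And>r. strict_mono r \<Longrightarrow> convergent (x \<circ> r) \<Longrightarrow>
      0 < liminf (\<lambda>n. ereal (nqn_ratio f \<delta> \<tau> (e (r n)) (x (r n))))"
  shows "x \<longlonglongrightarrow> p"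
proof -
  obtain \<mu> where \<mu>: "0 < \<mu>" "\<mu> < 1" "lojasiewicz_ineq f p \<mu>"
    using loj unfolding lojasiewicz_at_def by blast
  obtain c where c: "0 < c" "\<And>k. dist (x k) p < 1 \<Longrightarrow> c \<le> nqn_ratio f \<delta> \<tau> (e k) (x k)"
    using ratio_lower_bound[OF liminf] by metis
  show ?thesis
  proof (rule lojasiewicz_imp_limit[OF s \<mu>(3,1), of 1 1 "sqrt c / 3"])
    fix k assume k: "dist (x k) p < 1"
    have "sqrt c * (norm (wh k) * norm (g k))
        \<le> sqrt (nqn_ratio f \<delta> \<tau> (e k) (x k)) * (norm (wh k) * norm (g k))"
      using c(2)[OF k] by (intro mult_right_mono) auto
    also have "\<dots> \<le> wh k \<bullet> g k" by (rule ratio_bounds(2))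
    finally show "sqrt c / 3 * dist (x (Suc k)) (x k) * norm (g k) powr 1 \<le> f (x k) - f (x (Suc k))"
      using descent_dist by simp
  qed (use \<mu> c(1) in auto)
qed

end

section \<open>Runs that reach a critical point, and the conclusion\<close>

lemma nqn_sequence_limit_at_critical:
  assumes "nqn_sequence f \<delta> \<tau> \<gamma>\<^sub>0 e x" "gradient f (x k) = 0"
  shows "x \<longlonglongrightarrow> x k"
proof -
  have "x n = x k" if "k \<le> n" for n
    using that
  proof (induction rule: dec_induct)
    case (step n)
    then show ?case
      using assms(1)[unfolded nqn_sequence_def, rule_format, of n] assms(2) by simp
  qed simp
  then show ?thesis by (intro tendsto_eventually eventually_sequentiallyI)
qed

theorem theorem1p3:
  fixes f :: "real^'n \<Rightarrow> real"
    and \<delta> :: "nat \<Rightarrow> real"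
    and \<tau> \<gamma>\<^sub>0 :: real
    and e :: "nat \<Rightarrow> 'n \<Rightarrow> real^'n"
    and x :: "nat \<Rightarrow> real^'n"
  assumes "C2_function f"
    and "lojasiewicz f"
    and "inj_on \<delta> {0..CARD('n)}"
    and "0 < \<tau>" and "\<tau> \<le> 1"
    and "0 < \<gamma>\<^sub>0" and "\<gamma>\<^sub>0 < 1"
    and "nqn_sequence f \<delta> \<tau> \<gamma>\<^sub>0 e x"
  shows
    "(countable {z. critical_point f z} \<and> gradient_lojasiewicz f
        \<longrightarrow> diverges_or_converges_critical f x)
     \<and>
     ((\<forall>z. critical_point f z \<longrightarrow> lojasiewicz_exponent f z * (1 + \<tau>) < 1) \<and>
      (\<tau> = 1 \<longrightarrow> gradient_lojasiewicz f)
        \<longrightarrow> diverges_or_converges_critical f x)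
     \<and>
     ((\<forall>r::nat \<Rightarrow> nat. strict_mono r \<and> convergent (x \<circ> r) \<and> (\<forall>n. gradient f (x (r n)) \<noteq> 0)
         \<longrightarrow> 0 < liminf (\<lambda>n. ereal (nqn_ratio f \<delta> \<tau> (e (r n)) (x (r n))))) \<and>
      (\<tau> = 1 \<longrightarrow> gradient_lojasiewicz f)
        \<longrightarrow> diverges_or_converges_critical f x)"
proof -
  \<comment> \<open>Reduction shared by the three parts: a run that neither diverges nor reaches a
    critical point has a cluster point, which is critical. It remains to show convergence to
    it.\<close>
  have *: "diverges_or_converges_critical f x"
    if "\<And>s p. nqn_run f \<delta> \<tau> \<gamma>\<^sub>0 e x \<Longrightarrow> lojasiewicz_at f p \<Longrightarrow> critical_point f p \<Longrightarrow>
      strict_mono s \<Longrightarrow> (x \<circ> s) \<longlonglongrightarrow> p \<Longrightarrow> x \<longlonglongrightarrow> p"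
  proof (cases "filterlim (\<lambda>n. norm (x n)) at_top sequentially \<or> (\<exists>k. gradient f (x k) = 0)")
    case True
    then show ?thesis
      unfolding diverges_or_converges_critical_def critical_point_def
      using nqn_sequence_limit_at_critical[OF assms(8)] by metis
  next
    case False
    then have run: "nqn_run f \<delta> \<tau> \<gamma>\<^sub>0 e x"
      using assms by unfold_locales auto
    obtain s p where s: "strict_mono s" "(x \<circ> s) \<longlonglongrightarrow> p"
      using False not_diverges_imp_cluster_point by metis
    have crit: "critical_point f p"
      using nqn_run.cluster_point_critical[OF run s] by (simp add: critical_point_def)
    moreover have "lojasiewicz_at f p" using assms(2) crit by (simp add: lojasiewicz_def)
    ultimately have "x \<longlonglongrightarrow> p" using that[OF run _ _ s] by simp
    then show ?thesis using crit unfolding diverges_or_converges_critical_def by blast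
  qed
  show ?thesis
  proof (intro conjI impI; elim conjE; rule *)
    fix s p
    assume run: "nqn_run f \<delta> \<tau> \<gamma>\<^sub>0 e x" and loj: "lojasiewicz_at f p" and crit: "critical_point f p"
      and s: "strict_mono s" "(x \<circ> s) \<longlonglongrightarrow> p"
    interpret nqn_run f \<delta> \<tau> \<gamma>\<^sub>0 e x by (rule run)
    show "x \<longlonglongrightarrow> p" if "countable {z. critical_point f z}" "gradient_lojasiewicz f"
      using limit_of_gradient_lojasiewicz[OF s that] .
    show "x \<longlonglongrightarrow> p"
      if "\<forall>z. critical_point f z \<longrightarrow> lojasiewicz_exponent f z * (1 + \<tau>) < 1"
      using that crit by (intro limit_of_small_exponent[OF s loj]) simp
    show "x \<longlonglongrightarrow> p"
      if "\<forall>r::nat \<Rightarrow> nat. strict_mono r \<and> convergent (x \<circ> r) \<and> (\<forall>n. gradient f (x (r n)) \<noteq> 0)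
         \<longrightarrow> 0 < liminf (\<lambda>n. ereal (nqn_ratio f \<delta> \<tau> (e (r n)) (x (r n))))"
      using that noncritical by (intro limit_of_bounded_ratio[OF s loj]) simp
  qed
qed

end
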